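(* Let $m\in\mathbb{N}$, $0<R\le\infty$, $F\in\mathcal{H}^m_R$, and let $f_i:\Omega\to(-R,R)$ satisfy $\int_{\Omega}\left|\frac{\partial^{\boldsymbol 1}f_i(\boldsymbol x)}{\Delta\boldsymbol x^{\boldsymbol 1}}\right|\Delta\boldsymbol x<R$ for $i=1,\dots,m$. If $f_i\in\mathcal{L}^1_{\boldsymbol a}(\Omega,1,\boldsymbol 1)$ for all $i=1,\dots,m$, then $$\int_{\Omega}\left(\sum_{i=1}^m D_iF(|f_1(\boldsymbol x)|,\dots,|f_m(\boldsymbol x)|)\left|\frac{\partial^{\boldsymbol 1}f_i(\boldsymbol x)}{\Delta\boldsymbol x^{\boldsymbol 1}}\right|\right)\Delta\boldsymbol x\ \le\ F\left(\int_{\Omega}\left|\frac{\partial^{\boldsymbol 1}f_1(\boldsymbol x)}{\Delta\boldsymbol x^{\boldsymbol 1}}\right|\Delta\boldsymbol x,\dots,\int_{\Omega}\left|\frac{\partial^{\boldsymbol 1}f_m(\boldsymbol x)}{\Delta\boldsymbol x^{\boldsymbol 1}}\right|\Delta\boldsymbol x\right).$$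
   Context: Let $n\in\mathbb{N}$, let $\mathbb{T}_1,\dots,\mathbb{T}_n$ be time scales (nonempty closed subsets of $\mathbb{R}$) with forward jump operators $\sigma_j$, and $\Lambda^n=\mathbb{T}_1\times\cdots\times\mathbb{T}_n$. Inequalities between vectors are componentwise ($\boldsymbol x<\boldsymbol y$ means $x_j<y_j$ for all $j$). Let $\boldsymbol a,\boldsymbol b\in\Lambda^n$ with $\boldsymbol a<\boldsymbol b$ and $\Omega=\{\boldsymbol x\in\Lambda^n:\boldsymbol a\le\boldsymbol x\le\boldsymbol b\}$. $\int_\Omega f\,\Delta\boldsymbol x$ denotes the $n$-fold iterated delta integral $\int_{a_1}^{b_1}\cdots\int_{a_n}^{b_n}f\,\Delta x_1\cdots\Delta x_n$. The partial delta derivative $\frac{\partial f(\boldsymbol x)}{\Delta_jx_j}$ is $\lim_{t_j\to x_j,\ t_j\ne\sigma_j(x_j)}\frac{f(x_1,\dots,\sigma_j(x_j),\dots,x_n)-f(x_1,\dots,t_j,\dots,x_n)}{\sigma_j(x_j)-t_j}$; higher-order ones are defined by iteration. $\boldsymbol 1=(1,\dots,1)$ and $\frac{\partial^{\boldsymbol 1}f}{\Delta\boldsymbol x^{\boldsymbol 1}}=\frac{\partial^{n}f}{\Delta_1x_1\cdots\Delta_nx_n}$. $\mathcal{L}^1_{\boldsymbol a}(\Omega,1,\boldsymbol 1)$ is the set of all $f:\Omega\to\mathbb{R}$ which have rd-continuous derivatives $\frac{\partial^{j}f}{\Delta_1x_1\cdots\Delta_jx_j}$ for $j=1,\dots,n$,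 with $f(\boldsymbol x)|_{x_j=a_j}=0$ for $j=1,\dots,n$, and with $\int_\Omega\left|\frac{\partial^{\boldsymbol 1}f(\boldsymbol x)}{\Delta\boldsymbol x^{\boldsymbol 1}}\right|\Delta\boldsymbol x<\infty$. $\mathcal{H}^m_R$ is the set of all functions $F:(-R,R)^m\to\mathbb{R}$ such that (1) $F\in C^1((-R,R)^m)$; (2) $F(0,\dots,0)=0$; (3) for each $i=1,\dots,m$ the partial derivative $D_iF=\partial F/\partial t_i$ is non-negative and increasing in each variable on $(0,R)$ (arguments in $(0,R)^m$). "Increasing" means non-decreasing. *)

theory Defs
  imports "HOL-Analysis.Analysis"
begin

section \<open>Time scales\<close>

definition time_scale :: "real set \<Rightarrow> bool" where
  "time_scale T \<longleftrightarrow> T \<noteq> {} \<and> closed T"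

text \<open>The forward jump operator, with the usual convention that the infimum of the empty set is
  \<open>Sup T\<close>. It is defined at every real number, not only on \<open>T\<close>; the extension is the
  distribution function of the Lebesgue delta measure below.\<close>

definition fjump :: "real set \<Rightarrow> real \<Rightarrow> real" where
  "fjump T t = (if \<exists>s\<in>T. t < s then Inf {s\<in>T. t < s} else Sup T)"

definition bjump :: "real set \<Rightarrow> real \<Rightarrow> real" where
  "bjump T t = (if \<exists>s\<in>T. s < t then Sup {s\<in>T. s < t} else Inf T)"

definition right_dense :: "real set \<Rightarrow> real \<Rightarrow> bool" where
  "right_dense T t \<longleftrightarrow> t \<in> T \<and> (\<exists>s\<in>T. t < s) \<and> fjump T t = t"

definition left_dense :: "real set \<Rightarrow> real \<Rightarrow> bool" where
  "left_dense T t \<longleftrightarrow> t \<in> T \<and> (\<exists>s\<in>T. s < t) \<and> bjump T t = t"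

definition ts_kappa :: "real set \<Rightarrow> real set" where
  "ts_kappa T = {t\<in>T. \<not> (bjump T t < t \<and> (\<forall>s\<in>T. s \<le> t))}"

definition rd_continuous_on :: "real set \<Rightarrow> (real \<Rightarrow> real) \<Rightarrow> bool" where
  "rd_continuous_on T g \<longleftrightarrow>
     (\<forall>t. right_dense T t \<longrightarrow> continuous (at t within T) g) \<and>
     (\<forall>t. left_dense T t \<longrightarrow> (\<exists>l. (g \<longlongrightarrow> l) (at t within (T \<inter> {..<t}))))"


section \<open>Delta derivatives\<close>

text \<open>The filter only excludes the point \<open>fjump T x\<close>. In particular \<open>t = x\<close> is admitted when \<open>x\<close> is
  right-scattered, so that the limit then is the difference quotient, provided that
  \<open>g\<close> is continuous at \<open>x\<close>. (The filter \<open>at x within T\<close> would leave \<open>x\<close> out.)\<close>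

definition delta_filter :: "real set \<Rightarrow> real \<Rightarrow> real filter" where
  "delta_filter T x = inf (nhds x) (principal (T - {fjump T x}))"

definition has_delta_deriv :: "real set \<Rightarrow> (real \<Rightarrow> real) \<Rightarrow> real \<Rightarrow> real \<Rightarrow> bool" where
  "has_delta_deriv T g D x \<longleftrightarrow>
     ((\<lambda>t. (g (fjump T x) - g t) / (fjump T x - t)) \<longlongrightarrow> D) (delta_filter T x)"

definition delta_deriv :: "real set \<Rightarrow> (real \<Rightarrow> real) \<Rightarrow> real \<Rightarrow> real" where
  "delta_deriv T g x = (THE D. has_delta_deriv T g D x)"

text \<open>Points of a product of \<open>n\<close> time scales are functions in \<open>PiE {..<n} T\<close>, so the coordinates are
  numbered from \<open>0\<close> to \<open>n - 1\<close>. \<open>delta_partials T j f\<close> is the derivative in the first \<open>j\<close>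
  variables, one at a time, starting with the first one.\<close>

primrec delta_partials ::
  "(nat \<Rightarrow> real set) \<Rightarrow> nat \<Rightarrow> ((nat \<Rightarrow> real) \<Rightarrow> real) \<Rightarrow> (nat \<Rightarrow> real) \<Rightarrow> real" where
  "delta_partials T 0 f = f"
| "delta_partials T (Suc j) f =
     (\<lambda>x. delta_deriv (T j) (\<lambda>t. delta_partials T j f (x(j := t))) (x j))"

text \<open>The factors of the domain of \<open>delta_partials T j f\<close>: a left-scattered maximum is removed in
  each variable with respect to which a derivative has been taken.\<close>

definition partials_dom :: "(nat \<Rightarrow> real set) \<Rightarrow> nat \<Rightarrow> nat \<Rightarrow> real set" where
  "partials_dom T j i = (if i < j then ts_kappa (T i) else T i)"

definition has_delta_partials ::
  "(nat \<Rightarrow> real set) \<Rightarrow> nat \<Rightarrow> nat \<Rightarrow> ((nat \<Rightarrow> real) \<Rightarrow> real) \<Rightarrow> bool" where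
  "has_delta_partials T n j f \<longleftrightarrow>
     (\<forall>i<j. \<forall>x\<in>PiE {..<n} (partials_dom T (Suc i)).
        \<exists>D. has_delta_deriv (T i) (\<lambda>t. delta_partials T i f (x(i := t))) D (x i))"

text \<open>Rd-continuity of a function of \<open>n\<close> variables: rd-continuity in each variable, with the
  others fixed. No joint limits are required, which makes this the weakest reading of the notion.\<close>

definition rd_continuous_prod ::
  "(nat \<Rightarrow> real set) \<Rightarrow> nat \<Rightarrow> ((nat \<Rightarrow> real) \<Rightarrow> real) \<Rightarrow> bool" where
  "rd_continuous_prod T n g \<longleftrightarrow>
     (\<forall>x\<in>PiE {..<n} T. \<forall>j<n. rd_continuous_on (T j) (\<lambda>t. g (x(j := t))))"


section \<open>Delta integrals\<close>

text \<open>The Lebesgue delta measure of a time scale assigns \<open>t - s\<close> to \<open>T \<inter> {s..<t}\<close> for \<open>s \<le> t\<close> in \<open>T\<close>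
  (lemma \<open>emeasure_delta_measure\<close> below). It is the Lebesgue-Stieltjes measure of the forward jump
  operator.\<close>

definition delta_measure :: "real set \<Rightarrow> real measure" where
  "delta_measure T = interval_measure (fjump T)"

text \<open>Iterated integrals over the half-open boxes \<open>a \<le> x < b\<close>. The integral in the last variable
  is the innermost one. The base point \<open>\<lambda>_. undefined\<close> is the element of \<open>PiE {..<0} T\<close>.\<close>

primrec delta_integral ::
  "(nat \<Rightarrow> real set) \<Rightarrow> (nat \<Rightarrow> real) \<Rightarrow> (nat \<Rightarrow> real) \<Rightarrow> nat \<Rightarrow> ((nat \<Rightarrow> real) \<Rightarrow> real) \<Rightarrow> real" where
  "delta_integral T a b 0 g = g (\<lambda>_. undefined)"
| "delta_integral T a b (Suc n) g =
     delta_integral T a b n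
       (\<lambda>x. set_lebesgue_integral (delta_measure (T n)) (T n \<inter> {a n..<b n}) (\<lambda>t. g (x(n := t))))"

text \<open>The same for non-negative functions, with the value \<open>\<infinity>\<close> allowed. It serves to express
  finiteness, since the Bochner integral of a non-integrable function is \<open>0\<close>.\<close>

primrec delta_nn_integral ::
  "(nat \<Rightarrow> real set) \<Rightarrow> (nat \<Rightarrow> real) \<Rightarrow> (nat \<Rightarrow> real) \<Rightarrow> nat \<Rightarrow> ((nat \<Rightarrow> real) \<Rightarrow> ennreal) \<Rightarrow> ennreal"
where
  "delta_nn_integral T a b 0 g = g (\<lambda>_. undefined)"
| "delta_nn_integral T a b (Suc n) g =
     delta_nn_integral T a b n
       (\<lambda>x. set_nn_integral (delta_measure (T n)) (T n \<inter> {a n..<b n}) (\<lambda>t. g (x(n := t))))"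

context
  fixes T :: "real set"
  assumes T: "time_scale T"
begin

lemma fjump_le: "s \<in> T \<Longrightarrow> t < s \<Longrightarrow> fjump T t \<le> s"
  unfolding fjump_def by (auto intro!: cInf_lower bdd_belowI[of _ t])

lemma fjump_ge: "s \<in> T \<Longrightarrow> t < s \<Longrightarrow> t \<le> fjump T t"
  unfolding fjump_def by (auto intro!: cInf_greatest)

lemma fjump_top: "\<forall>s\<in>T. s \<le> t \<Longrightarrow> fjump T t = Sup T"
  unfolding fjump_def by (auto simp: not_less)

lemma fjump_top_eq: "\<forall>s\<in>T. s \<le> t \<Longrightarrow> t \<in> T \<Longrightarrow> fjump T t = t"
  by (simp add: fjump_top) (auto intro: cSup_eq_maximum)

lemma fjump_mono: "x \<le> y \<Longrightarrow> fjump T x \<le> fjump T y"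
proof -
  assume xy: "x \<le> y"
  consider (1) "\<exists>s\<in>T. y < s" | (2) "\<exists>s\<in>T. x < s" "\<forall>s\<in>T. s \<le> y" | (3) "\<forall>s\<in>T. s \<le> x"
    by force
  then show ?thesis
  proof cases
    case 1
    then obtain s where s: "s \<in> T" "y < s" by auto
    have "Inf {s\<in>T. x < s} \<le> Inf {s\<in>T. y < s}"
      using s xy by (intro cInf_superset_mono) (auto intro: bdd_belowI[of _ x])
    with 1 xy show ?thesis unfolding fjump_def by force
  next
    case 2
    then obtain s where s: "s \<in> T" "x < s" by auto
    have "fjump T x \<le> s" using s by (rule fjump_le)
    also have "s \<le> Sup T" using s 2 by (intro cSup_upper) (auto intro: bdd_aboveI)
    finally show ?thesis using 2 by (simp add: fjump_top)
  next
    case 3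
    with xy have "\<forall>s\<in>T. s \<le> y" by force
    with 3 show ?thesis by (simp add: fjump_top)
  qed
qed

lemma fjump_right_cont: "continuous (at_right t) (fjump T)"
proof -
  have "\<forall>\<^sub>F u in at_right t. dist (fjump T u) (fjump T t) < e" if e: "e > 0" for e
  proof (cases "\<exists>s\<in>T. t < s")
    case True
    then obtain s0 where s0: "s0 \<in> T" "t < s0" by auto
    have "Inf {s\<in>T. t < s} < fjump T t + e"
      using True e by (simp add: fjump_def)
    then obtain s where s: "s \<in> T" "t < s" "s < fjump T t + e"
      using s0 by (subst (asm) cInf_less_iff) (auto intro: bdd_belowI[of _ t])
    have "\<forall>\<^sub>F u in at_right t. t < u \<and> u < s"
      using s(2) by (auto simp: eventually_at_right)
    then show ?thesis
    proof eventually_elim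
      case (elim u)
      then show ?case
        using fjump_le[of s u] fjump_mono[of t u] s by (auto simp: dist_real_def)
    qed
  next
    case False
    have "\<forall>\<^sub>F u in at_right t. t < u"
      by (simp add: eventually_at_right_less)
    then show ?thesis
    proof eventually_elim
      case (elim u)
      then have "\<forall>s\<in>T. s \<le> u" "\<forall>s\<in>T. s \<le> t" using False by force+
      then show ?case using e by (simp add: fjump_top)
    qed
  qed
  then show ?thesis
    unfolding continuous_within by (auto intro: tendstoI)
qed

lemma emeasure_delta_measure_Ioc:
  "u \<le> t \<Longrightarrow> emeasure (delta_measure T) {u<..t} = ennreal (fjump T t - fjump T u)"
  unfolding delta_measure_def
  by (intro emeasure_interval_measure_Ioc fjump_mono fjump_right_cont) auto

lemma emeasure_delta_measure_point:
  assumes t: "t \<in> T"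
  shows "emeasure (delta_measure T) {t} = ennreal (fjump T t - t)"
proof (rule LIMSEQ_unique)
  let ?X = "\<lambda>k. {t - 1 / real (Suc k)<..t}"
  have m: "emeasure (delta_measure T) (?X k)
      = ennreal (fjump T t - fjump T (t - 1 / real (Suc k)))" for k
    by (rule emeasure_delta_measure_Ioc) auto
  have I: "(\<Inter>k. ?X k) = {t}"
  proof (intro equalityI subsetI)
    fix x assume x: "x \<in> (\<Inter>k. ?X k)"
    have "(\<lambda>k. t - 1 / real (Suc k)) \<longlonglongrightarrow> t - 0"
      by (intro tendsto_intros LIMSEQ_Suc[OF lim_const_over_n])
    then have "t - 0 \<le> x" using x by (intro LIMSEQ_le_const2) (auto intro: less_imp_le)
    with x show "x \<in> {t}" by auto
  qed auto
  have "(\<lambda>k. emeasure (delta_measure T) (?X k)) \<longlonglongrightarrow> emeasure (delta_measure T) (\<Inter>k. ?X k)"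
  proof (rule Lim_emeasure_decseq)
    show "range ?X \<subseteq> sets (delta_measure T)" by (auto simp: delta_measure_def)
    show "decseq ?X"
      unfolding decseq_def
    proof (intro allI impI subsetI)
      fix k l :: nat and x assume kl: "k \<le> l" and x: "x \<in> ?X l"
      have "1 / real (Suc l) \<le> 1 / real (Suc k)" using kl by (intro divide_left_mono) auto
      with x show "x \<in> ?X k" by auto
    qed
    show "emeasure (delta_measure T) (?X k) \<noteq> \<infinity>" for k by (simp only: m) simp
  qed
  then show "(\<lambda>k. emeasure (delta_measure T) (?X k)) \<longlonglongrightarrow> emeasure (delta_measure T) {t}"
    by (simp only: I)
  have "(\<lambda>k. fjump T (t - 1 / real (Suc k))) \<longlonglongrightarrow> t"
  proof (rule tendsto_sandwich)
    have "(\<lambda>k. t - 1 / real (Suc k)) \<longlonglongrightarrow> t - 0"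
      by (intro tendsto_intros LIMSEQ_Suc[OF lim_const_over_n])
    then show "(\<lambda>k. t - 1 / real (Suc k)) \<longlonglongrightarrow> t" by simp
    show "\<forall>\<^sub>F k in sequentially. t - 1 / real (Suc k) \<le> fjump T (t - 1 / real (Suc k))"
      using t by (auto intro!: always_eventually fjump_ge[of t])
    show "\<forall>\<^sub>F k in sequentially. fjump T (t - 1 / real (Suc k)) \<le> t"
      using t by (auto intro!: always_eventually fjump_le)
  qed simp
  then show "(\<lambda>k. emeasure (delta_measure T) (?X k)) \<longlonglongrightarrow> ennreal (fjump T t - t)"
    unfolding m by (intro tendsto_intros)
qed

lemma emeasure_delta_measure_gap:
  assumes "s \<in> T" "t \<in> T"
  shows "emeasure (delta_measure T) ({s..<t} - T) = 0"
proof -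
  let ?I = "{(p, q). p \<in> \<rat> \<and> q \<in> \<rat> \<and> p \<le> q \<and> {p..q} \<inter> T = {} \<and> q \<le> t}"
  have cI: "countable ?I"
    by (rule countable_subset[of _ "\<rat> \<times> \<rat>"]) (auto intro: countable_rat)
  have n: "(case i of (p, q) \<Rightarrow> {p<..q}) \<in> null_sets (delta_measure T)" if "i \<in> ?I" for i
  proof -
    obtain p q where i: "i = (p, q)" by force
    with that have pq: "p \<le> q" "{p..q} \<inter> T = {}" "q \<le> t" by auto
    have qt: "q < t" using pq assms by (cases "q = t") auto
    have "p < x \<longleftrightarrow> q < x" if "x \<in> T" for x
    proof -
      have "\<not> (p \<le> x \<and> x \<le> q)" using pq(2) that by auto
      with pq(1) show ?thesis by linarith
    qed
    then have "{s\<in>T. p < s} = {s\<in>T. q < s}" by auto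
    then have "fjump T p = fjump T q" using assms(2) qt pq(1) by (auto simp: fjump_def)
    then have "emeasure (delta_measure T) {p<..q} = 0"
      using pq by (simp add: emeasure_delta_measure_Ioc)
    then show ?thesis unfolding i by (auto intro!: null_setsI simp: delta_measure_def)
  qed
  have "{s..<t} - T \<subseteq> (\<Union>i\<in>?I. case i of (p, q) \<Rightarrow> {p<..q})"
  proof
    fix x assume x: "x \<in> {s..<t} - T"
    have "open (- T)" using T by (auto simp: time_scale_def)
    then obtain e where e: "e > 0" "ball x e \<subseteq> - T" using x by (auto simp: open_contains_ball)
    obtain p where p: "p \<in> \<rat>" "x - e < p" "p < x"
      using Rats_dense_in_real[of "x - e" x] e by auto
    obtain q where q: "q \<in> \<rat>" "x < q" "q < min (x + e) t"
      using Rats_dense_in_real[of x "min (x + e) t"] e x by auto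
    have "{p..q} \<subseteq> ball x e" using p q by (auto simp: dist_real_def)
    with e p q have "(p, q) \<in> ?I" by auto
    then show "x \<in> (\<Union>i\<in>?I. case i of (p, q) \<Rightarrow> {p<..q})" using p q by force
  qed
  moreover have "(\<Union>i\<in>?I. case i of (p, q) \<Rightarrow> {p<..q}) \<in> null_sets (delta_measure T)"
    using cI n by (rule null_sets_UN')
  moreover have "{s..<t} - T \<in> sets (delta_measure T)"
    using T by (auto simp: delta_measure_def time_scale_def)
  ultimately show ?thesis by (meson null_setsD1 null_sets_subset)
qed

lemma emeasure_delta_measure:
  assumes st: "s \<in> T" "t \<in> T" "s \<le> t"
  shows "emeasure (delta_measure T) (T \<inter> {s..<t}) = ennreal (t - s)"
proof (cases "s = t")
  case False
  with st have lt: "s < t" by simp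
  let ?M = "delta_measure T"
  have sets: "A \<in> sets ?M" if "A \<in> sets borel" for A
    using that by (simp add: delta_measure_def)
  have bor: "T \<in> sets borel" using T by (auto simp: time_scale_def)
  have ge: "t \<le> fjump T t"
    using fjump_ge[of _ t] fjump_top_eq[of t] st by (cases "\<forall>s\<in>T. s \<le> t") (auto simp: not_le)
  have s1: "s \<le> fjump T s" and s2: "fjump T s \<le> t" using fjump_ge[of t s] fjump_le[of t s] st lt by auto
  have "emeasure ?M {s..<t} + emeasure ?M {t} = emeasure ?M {s..t}"
    using lt by (subst plus_emeasure) (auto intro!: sets arg_cong[where f = "emeasure ?M"])
  also have "\<dots> = emeasure ?M {s} + emeasure ?M {s<..t}"
    using lt by (subst plus_emeasure) (auto intro!: sets arg_cong[where f = "emeasure ?M"])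
  also have "\<dots> = ennreal (fjump T t - s)"
    using st s1 s2 ge
    by (simp add: emeasure_delta_measure_point emeasure_delta_measure_Ioc flip: ennreal_plus)
  also have "\<dots> = ennreal (t - s) + emeasure ?M {t}"
    using st ge by (simp add: emeasure_delta_measure_point flip: ennreal_plus)
  finally have "emeasure ?M {s..<t} = ennreal (t - s)"
    using st by (simp add: emeasure_delta_measure_point)
  moreover have "emeasure ?M {s..<t} = emeasure ?M (T \<inter> {s..<t}) + emeasure ?M ({s..<t} - T)"
    using bor by (subst plus_emeasure) (auto intro!: sets arg_cong[where f = "emeasure ?M"])
  ultimately show ?thesis using st emeasure_delta_measure_gap by simp
qed simp

end


section \<open>The function classes\<close>

definition ts_box ::
  "(nat \<Rightarrow> real set) \<Rightarrow> (nat \<Rightarrow> real) \<Rightarrow> (nat \<Rightarrow> real) \<Rightarrow> nat \<Rightarrow> real set" where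
  "ts_box T a b j = T j \<inter> {a j..b j}"

text \<open>A function on the box is differentiated over the factors \<open>ts_box T a b j\<close>, which are time
  scales themselves. Their forward jump operators agree with those of \<open>T j\<close> except possibly at the
  maximum \<open>b j\<close>, where the forward jump in \<open>T j\<close> may lead out of the box.\<close>

definition mixed_deriv ::
  "(nat \<Rightarrow> real set) \<Rightarrow> (nat \<Rightarrow> real) \<Rightarrow> (nat \<Rightarrow> real) \<Rightarrow> nat \<Rightarrow>
     ((nat \<Rightarrow> real) \<Rightarrow> real) \<Rightarrow> (nat \<Rightarrow> real) \<Rightarrow> real" where
  "mixed_deriv T a b n f = delta_partials (ts_box T a b) n f"

definition class_L ::
  "(nat \<Rightarrow> real set) \<Rightarrow> (nat \<Rightarrow> real) \<Rightarrow> (nat \<Rightarrow> real) \<Rightarrow> nat \<Rightarrow> ((nat \<Rightarrow> real) \<Rightarrow> real) set" where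
  "class_L T a b n = {f.
     has_delta_partials (ts_box T a b) n n f \<and>
     (\<forall>j\<in>{1..n}. rd_continuous_prod (partials_dom (ts_box T a b) j) n
        (delta_partials (ts_box T a b) j f)) \<and>
     (\<forall>x\<in>PiE {..<n} (ts_box T a b). \<forall>j<n. x j = a j \<longrightarrow> f x = 0) \<and>
     delta_nn_integral T a b n (\<lambda>x. ennreal \<bar>mixed_deriv T a b n f x\<bar>) < \<infinity>}"

definition vec_upd :: "real ^ 'm \<Rightarrow> 'm \<Rightarrow> real \<Rightarrow> real ^ 'm" where
  "vec_upd t i s = (\<chi> k. if k = i then s else t $ k)"

definition partial_deriv :: "'m \<Rightarrow> (real ^ 'm \<Rightarrow> real) \<Rightarrow> real ^ 'm \<Rightarrow> real" where
  "partial_deriv i F t = deriv (\<lambda>s. F (vec_upd t i s)) (t $ i)"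

definition open_cube :: "ereal \<Rightarrow> (real ^ 'm) set" where
  "open_cube R = {t. \<forall>i. - R < ereal (t $ i) \<and> ereal (t $ i) < R}"

definition pos_cube :: "ereal \<Rightarrow> (real ^ 'm) set" where
  "pos_cube R = {t. \<forall>i. 0 < t $ i \<and> ereal (t $ i) < R}"

definition C1_on_cube :: "ereal \<Rightarrow> (real ^ 'm \<Rightarrow> real) \<Rightarrow> bool" where
  "C1_on_cube R F \<longleftrightarrow>
     (\<forall>i. (\<forall>t\<in>open_cube R. (\<lambda>s. F (vec_upd t i s)) differentiable (at (t $ i))) \<and>
          continuous_on (open_cube R) (partial_deriv i F))"

definition class_H :: "ereal \<Rightarrow> (real ^ 'm \<Rightarrow> real) set" where
  "class_H R = {F.
     C1_on_cube R F \<and>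
     F 0 = 0 \<and>
     (\<forall>i. \<forall>t\<in>pos_cube R. 0 \<le> partial_deriv i F t) \<and>
     (\<forall>i k. \<forall>t\<in>pos_cube R. \<forall>s. t $ k \<le> s \<and> ereal s < R \<longrightarrow>
        partial_deriv i F t \<le> partial_deriv i F (vec_upd t k s))}"

end

theory Submission
  imports Defs
begin

text \<open>Integrating the mixed derivative one variable at a time, and using that \<open>f\<^sub>i\<close> vanishes on the
  faces \<open>x\<^sub>j = a\<^sub>j\<close>, gives \<open>\<bar>f\<^sub>i(x)\<bar> \<le> H\<^sub>i(x\<^sub>0)\<close>, where \<open>H\<^sub>i(t)\<close> is the integral of \<open>\<bar>\<partial>\<^sup>1 f\<^sub>i\<bar>\<close> over
  the slab of the points of the box with \<open>x\<^sub>0 < t\<close>. Since the \<open>D\<^sub>i F\<close> are monotone, the left-hand side is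
  at most the integral over \<open>t\<close> of \<open>\<Sum>\<^sub>i D\<^sub>i F(H(t)) dH\<^sub>i(t)\<close>. A sum of \<open>D\<^sub>i F(H) \<Delta>H\<^sub>i\<close> with \<open>D\<^sub>i F\<close>
  evaluated at left endpoints is dominated by the increments of \<open>F \<circ> H\<close>, which telescope to
  \<open>F(H(b\<^sub>0))\<close>.\<close>

section \<open>Measurability of separately rd-continuous functions\<close>

text \<open>Three obstacles shape the argument. The delta measure has atoms at right-scattered
  points, so no exact chain rule for \<open>F \<circ> H\<close> can be expected. The strict
  inequality in the slab keeps an atom at \<open>t\<close> out of \<open>H(t)\<close>, so evaluating
  the monotone derivatives there errs on the small side and an inequality survives. Next, finiteness
  is assumed only for the full iterated integral: inner integrals may be infinite for exceptional
  values of the outer variables, and a Bochner integral that does not exist is 0. The bounds on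
  \<open>f\<close> are therefore inequalities in \<open>ennreal\<close>, valid on every slice, and
  the passage to real values happens almost everywhere. Finally, rd-continuity is given in each
  variable separately and only on the truncated factors \<open>ts_kappa\<close>, so measurable
  representatives on the whole space have to be constructed first. Cutting only the first coordinate
  suffices: the bound on \<open>f\<close> then depends on a single variable, and the n-dimensional
  inequality reduces to a Stieltjes-type estimate on the line.\<close>

lemma measurable_right_continuous_compose:
  fixes G :: "'a \<Rightarrow> real \<Rightarrow> real"
  assumes G: "\<And>t. (\<lambda>x. G x t) \<in> borel_measurable M"
    and cont: "\<And>x t. x \<in> space M \<Longrightarrow> continuous (at_right t) (G x)"
    and u[measurable]: "u \<in> borel_measurable M"
  shows "(\<lambda>x. G x (u x)) \<in> borel_measurable M"
proof (rule borel_measurable_LIMSEQ_real)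
  \<comment> \<open>\<open>r k t\<close> is the least multiple of 1/(k+1) strictly above
    \<open>t\<close>. It takes countably many values, which keeps the composition measurable, and
    strictness makes the approach one-sided, as right-continuity requires.\<close>
  define r where "r k t = (of_int \<lfloor>t * real (Suc k)\<rfloor> + 1) / real (Suc k)" for k and t :: real
  show "(\<lambda>k. G x (r k (u x))) \<longlonglongrightarrow> G x (u x)" if x: "x \<in> space M" for x
  proof -
    have gt: "u x < r k (u x)" for k
    proof -
      have "u x * real (Suc k) < of_int \<lfloor>u x * real (Suc k)\<rfloor> + 1" by linarith
      then show ?thesis by (simp add: r_def field_simps del: of_nat_Suc)
    qed
    have le: "r k (u x) \<le> u x + 1 / real (Suc k)" for k
    proof -
      have "of_int \<lfloor>u x * real (Suc k)\<rfloor> + 1 \<le> u x * real (Suc k) + 1" by linarith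
      then show ?thesis by (simp add: r_def field_simps del: of_nat_Suc)
    qed
    have "(\<lambda>k. u x + 1 / real (Suc k)) \<longlonglongrightarrow> u x + 0"
      by (intro tendsto_intros LIMSEQ_Suc[OF lim_const_over_n])
    then have up: "(\<lambda>k. u x + 1 / real (Suc k)) \<longlonglongrightarrow> u x" by simp
    have "(\<lambda>k. r k (u x)) \<longlonglongrightarrow> u x"
      by (rule tendsto_sandwich[OF _ _ tendsto_const up])
        (use gt le in \<open>simp_all add: less_imp_le del: of_nat_Suc\<close>)
    then have "filterlim (\<lambda>k. r k (u x)) (at_right (u x)) sequentially"
      using gt gt[THEN less_imp_neq, THEN not_sym]
      by (auto simp: filterlim_at intro!: always_eventually)
    with cont[OF x, of "u x"] show ?thesis
      unfolding continuous_within by (rule filterlim_compose)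
  qed
  show "(\<lambda>x. G x (r k (u x))) \<in> borel_measurable M" for k
  proof -
    have "(\<lambda>x. (\<lambda>(p::int) x. G x ((of_int p + 1) / real (Suc k))) \<lfloor>u x * real (Suc k)\<rfloor> x)
        \<in> borel_measurable M"
      by (rule measurable_compose_countable) (use G in measurable)
    then show ?thesis by (simp add: r_def)
  qed
qed

text \<open>The gap to the right of a right-scattered point \<open>s\<close> is filled with \<open>s\<close>, so that composing with
  this map turns rd-continuous functions into right-continuous functions on the whole line.\<close>

definition ts_floor :: "real set \<Rightarrow> real \<Rightarrow> real" where
  "ts_floor K t = Sup (K \<inter> {..max (Inf K) t})"

context
  fixes K :: "real set"
  assumes K: "closed K" "K \<noteq> {}" "bdd_below K"
begin

lemma Inf_in_closed: "Inf K \<in> K"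
  using K by (simp add: closed_contains_Inf)

lemma ts_floor_in: "ts_floor K t \<in> K \<inter> {..max (Inf K) t}"
  unfolding ts_floor_def
  by (rule closed_contains_Sup)
    (use K Inf_in_closed in \<open>auto intro!: closed_Int bdd_aboveI[of _ "max (Inf K) t"]\<close>)

lemma ts_floor_upper: "s \<in> K \<Longrightarrow> s \<le> max (Inf K) t \<Longrightarrow> s \<le> ts_floor K t"
  unfolding ts_floor_def
  by (rule cSup_upper) (auto intro!: bdd_aboveI[of _ "max (Inf K) t"])

lemma ts_floor_id: "t \<in> K \<Longrightarrow> ts_floor K t = t"
  using ts_floor_in[of t] ts_floor_upper[of t t] K cInf_lower[of t K] by auto

lemma right_denseI:
  assumes c: "c \<in> K" and e: "\<And>e. e > 0 \<Longrightarrow> \<exists>s\<in>K. c < s \<and> s < c + e"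
  shows "right_dense K c"
proof -
  have ex: "\<exists>s\<in>K. c < s" using e[of 1] by auto
  have "Inf {s\<in>K. c < s} \<le> c + d" if d: "d > 0" for d :: real
  proof -
    obtain s where "s \<in> K" "c < s" "s < c + d" using e[OF d] by auto
    moreover from this have "Inf {s\<in>K. c < s} \<le> s"
      by (intro cInf_lower) (auto intro: bdd_belowI[of _ c])
    ultimately show ?thesis by simp
  qed
  then have "Inf {s\<in>K. c < s} \<le> c" by (rule field_le_epsilon)
  moreover have "c \<le> Inf {s\<in>K. c < s}" using ex by (intro cInf_greatest) auto
  ultimately show ?thesis using c ex by (simp add: right_dense_def fjump_def)
qed

text \<open>Two cases at the clamped point \<open>m = max (Inf K) t\<close>. If \<open>K\<close>
  accumulates at \<open>m\<close> from the right, \<open>m\<close> is right-dense and the floor is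
  squeezed between \<open>m\<close> and \<open>max (Inf K) u\<close>; otherwise a gap follows
  \<open>m\<close>, and the composition is constant just after \<open>t\<close>.\<close>

lemma continuous_at_right_ts_floor:
  assumes rd: "rd_continuous_on K \<psi>"
  shows "continuous (at_right t) (\<lambda>t. \<psi> (ts_floor K t))"
proof -
  define m where "m = max (Inf K) t"
  have mlim: "((\<lambda>u. max (Inf K) u) \<longlongrightarrow> m) (at_right t)"
    unfolding m_def by (intro tendsto_intros)
  have mge: "\<forall>\<^sub>F u in at_right t. m \<le> max (Inf K) u"
    using eventually_at_right_less[of t] by eventually_elim (auto simp: m_def)
  show ?thesis
  proof (cases "\<forall>e>0. \<exists>s\<in>K. m < s \<and> s < m + e")
    case True
    have "m \<in> closure K"
      unfolding closure_approachable
    proof (intro allI impI)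
      fix e :: real assume "0 < e"
      with True obtain s where "s \<in> K" "m < s" "s < m + e" by auto
      then show "\<exists>y\<in>K. dist y m < e" by (intro bexI[of _ s]) (auto simp: dist_real_def)
    qed
    then have mK: "m \<in> K" using K by (simp add: closure_closed)
    have "right_dense K m" using mK True by (intro right_denseI) auto
    then have c: "(\<psi> \<longlongrightarrow> \<psi> m) (at m within K)"
      using rd by (auto simp: rd_continuous_on_def continuous_within)
    have fm: "ts_floor K t = m"
      using ts_floor_in[of t] ts_floor_upper[of m t] mK by (auto simp: m_def)
    have "((\<lambda>u. ts_floor K u) \<longlongrightarrow> m) (at_right t)"
    proof (rule tendsto_sandwich[OF _ _ tendsto_const mlim])
      show "\<forall>\<^sub>F u in at_right t. m \<le> ts_floor K u"
        using mge by eventually_elim (use mK in \<open>auto intro: ts_floor_upper\<close>)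
      show "\<forall>\<^sub>F u in at_right t. ts_floor K u \<le> max (Inf K) u"
        using ts_floor_in by (auto intro!: always_eventually)
    qed
    then have "((\<lambda>u. \<psi> (ts_floor K u)) \<longlongrightarrow> \<psi> m) (at_right t)"
      using c ts_floor_in
      by (intro continuous_within_tendsto_compose[of m K \<psi>])
        (auto intro!: always_eventually simp: continuous_within)
    then show ?thesis by (simp add: continuous_within fm)
  next
    case False
    then obtain e where e: "e > 0" "\<And>s. s \<in> K \<Longrightarrow> \<not> (m < s \<and> s < m + e)" by auto
    have "\<forall>\<^sub>F u in at_right t. max (Inf K) u < m + e"
      using mlim e by (intro order_tendstoD) auto
    with mge have "\<forall>\<^sub>F u in at_right t. \<psi> (ts_floor K u) = \<psi> (ts_floor K t)"
    proof eventually_elim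
      case (elim u)
      then have "s \<le> max (Inf K) u \<longleftrightarrow> s \<le> m" if "s \<in> K" for s using e(2)[OF that] by linarith
      then have "K \<inter> {..max (Inf K) u} = K \<inter> {..m}" by auto
      then show ?case by (simp add: ts_floor_def m_def)
    qed
    then show ?thesis unfolding continuous_within by (rule tendsto_eventually)
  qed
qed

lemma borel_measurable_rd_continuous:
  assumes "rd_continuous_on K \<psi>"
  shows "(\<lambda>t. \<psi> (ts_floor K t)) \<in> borel_measurable borel"
  using continuous_at_right_ts_floor[OF assms]
  by (intro measurable_right_continuous_compose[where G = "\<lambda>_ t. \<psi> (ts_floor K t)" and u = "\<lambda>t. t"])
    auto

end

text \<open>Separate regularity gives joint measurability by freeing one coordinate at a time: the
  induction is on the number \<open>j\<close> of free coordinates, the others being frozen at an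
  arbitrary point \<open>y\<close> of the domain. Each step is a Caratheodory argument, measurable
  in the old coordinates and right-continuous in the new one.\<close>

lemma borel_measurable_rd_continuous_prod:
  assumes K: "\<And>i. i < n \<Longrightarrow> closed (K i) \<and> K i \<noteq> {} \<and> bdd_below (K i)"
    and rd: "rd_continuous_prod K n g"
  shows "(\<lambda>x. g (\<lambda>i. if i < n then ts_floor (K i) (x i) else undefined))
    \<in> borel_measurable (Pi\<^sub>M {..<n} (\<lambda>_. borel))"
proof -
  have fl: "ts_floor (K i) t \<in> K i" if "i < n" for i t
    using ts_floor_in[of "K i" t] K[OF that] by auto
  have "(\<lambda>x. g (\<lambda>i. if i < j then ts_floor (K i) (x i) else y i))
      \<in> borel_measurable (Pi\<^sub>M {..<n} (\<lambda>_. borel))"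
    if "j \<le> n" "y \<in> PiE {..<n} K" for j y
    using that
  proof (induction j arbitrary: y)
    case (Suc j)
    define G where "G x t = g ((\<lambda>i. if i < j then ts_floor (K i) (x i) else y i)
      (j := ts_floor (K j) t))" for x :: "nat \<Rightarrow> real" and t
    have "(\<lambda>x. G x (x j)) \<in> borel_measurable (Pi\<^sub>M {..<n} (\<lambda>_. borel))"
    proof (rule measurable_right_continuous_compose[where G = G and u = "\<lambda>x. x j"])
      fix t
      have "y(j := ts_floor (K j) t) \<in> PiE {..<n} K"
        using Suc.prems fl by (auto simp: PiE_iff extensional_def)
      from Suc.IH[OF _ this] Suc.prems
      have "(\<lambda>x. g (\<lambda>i. if i < j then ts_floor (K i) (x i) else (y(j := ts_floor (K j) t)) i))
          \<in> borel_measurable (Pi\<^sub>M {..<n} (\<lambda>_. borel))"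
        by simp
      moreover have "(\<lambda>i. if i < j then ts_floor (K i) (x i) else (y(j := ts_floor (K j) t)) i)
          = (\<lambda>i. if i < j then ts_floor (K i) (x i) else y i)(j := ts_floor (K j) t)" for x
        by auto
      ultimately show "(\<lambda>x. G x t) \<in> borel_measurable (Pi\<^sub>M {..<n} (\<lambda>_. borel))"
        by (simp add: G_def)
    next
      fix x :: "nat \<Rightarrow> real" and t
      have "(\<lambda>i. if i < j then ts_floor (K i) (x i) else y i) \<in> PiE {..<n} K"
        using Suc.prems fl by (auto simp: PiE_iff extensional_def)
      then have "rd_continuous_on (K j)
          (\<lambda>t. g ((\<lambda>i. if i < j then ts_floor (K i) (x i) else y i)(j := t)))"
        using rd Suc.prems by (auto simp: rd_continuous_prod_def)
      then show "continuous (at_right t) (G x)"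
        using continuous_at_right_ts_floor[of "K j"] K[of j] Suc.prems by (simp add: G_def[abs_def])
    next
      show "(\<lambda>x. x j) \<in> borel_measurable (Pi\<^sub>M {..<n} (\<lambda>_. borel))"
        using Suc.prems measurable_component_singleton[of j "{..<n}" "\<lambda>_. borel"] by simp
    qed
    moreover have "G x (x j) = g (\<lambda>i. if i < Suc j then ts_floor (K i) (x i) else y i)" for x
      unfolding G_def by (rule arg_cong[where f = g]) auto
    ultimately show ?case by simp
  qed simp
  note * = this[of n "\<lambda>i. if i < n then Inf (K i) else undefined"]
  have "(\<lambda>i. if i < n then Inf (K i) else undefined) \<in> PiE {..<n} K"
    using K by (auto simp: PiE_iff extensional_def intro: Inf_in_closed)
  moreover have "(\<lambda>i. if i < n then ts_floor (K i) (x i) else (if i < n then Inf (K i) else undefined))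
      = (\<lambda>i. if i < n then ts_floor (K i) (x i) else undefined)" for x
    by auto
  ultimately show ?thesis using * by simp
qed

section \<open>The fundamental theorem as an inequality\<close>

locale ts_interval =
  fixes T :: "real set" and a b :: real
  assumes T: "time_scale T" and aT: "a \<in> T" and bT: "b \<in> T" and ab: "a < b"
begin

abbreviation "S \<equiv> T \<inter> {a..b}"

section \<open>Jump operators and the truncated set of a compact time scale interval\<close>

lemma closed_S: "closed S"
  using T by (auto simp: time_scale_def)

lemma sets_S: "T \<inter> {u..<v} \<in> sets (delta_measure T)"
  using T by (auto simp: time_scale_def delta_measure_def)

lemma kappa_S: "ts_kappa S = (if bjump S b < b then S - {b} else S)"
proof -
  have bS: "b \<in> S" using bT ab by auto
  have "\<not> (\<forall>s\<in>S. s \<le> t)" if "t \<in> S" "t \<noteq> b" for t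
    using that by (auto simp del: not_le intro!: bexI[OF _ bS])
  moreover have "\<forall>s\<in>S. s \<le> b" by auto
  ultimately have "t \<in> ts_kappa S \<longleftrightarrow> t \<in> S \<and> \<not> (t = b \<and> bjump S b < b)" for t
    unfolding ts_kappa_def by blast
  note * = this
  show ?thesis by (rule set_eqI, subst *) auto
qed

lemma Ico_subset_kappa: "T \<inter> {a..<b} \<subseteq> ts_kappa S"
  by (auto simp: kappa_S)

lemma le_bjump_S:
  assumes "s \<in> S" "s < c"
  shows "s \<le> bjump S c"
proof -
  have "bjump S c = Sup {s\<in>S. s < c}" using assms by (auto simp: bjump_def)
  then show ?thesis using assms by (auto intro!: cSup_upper bdd_aboveI[of _ c])
qed

lemma bjump_S_in:
  assumes "\<exists>s\<in>S. s < c" "bjump S c < c"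
  shows "bjump S c \<in> S"
proof -
  let ?A = "{s\<in>S. s < c}"
  have "?A = S \<inter> {..bjump S c}" using le_bjump_S assms(2) by force
  moreover have "closed (S \<inter> {..bjump S c})" by (intro closed_Int closed_S closed_atMost closed_atLeast)
  ultimately have "Sup ?A \<in> ?A"
    using assms by (intro closed_contains_Sup) (auto intro: bdd_aboveI[of _ c])
  then show ?thesis using assms by (auto simp: bjump_def)
qed

text \<open>A left-scattered maximum is isolated: removing it leaves
  \<open>S \<inter> {..bjump S b}\<close>.\<close>

lemma closed_kappa: "closed (ts_kappa S)"
proof (cases "bjump S b < b")
  case True
  have "ts_kappa S = S \<inter> {..bjump S b}"
    using True le_bjump_S[of _ b] by (force simp: kappa_S)
  moreover have "closed (S \<inter> {..bjump S b})" by (intro closed_Int closed_S closed_atMost closed_atLeast)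
  ultimately show ?thesis by simp
next
  case False
  then show ?thesis using closed_S by (simp only: kappa_S if_False)
qed

lemma a_in_kappa: "a \<in> ts_kappa S"
  using aT ab Ico_subset_kappa by auto

lemma bdd_kappa: "bdd_below (ts_kappa S)"
  by (auto simp: ts_kappa_def intro: bdd_belowI[of _ a])

lemma fjump_S_ge: "c \<in> S \<Longrightarrow> c \<le> fjump S c"
  by (cases "\<exists>s\<in>S. c < s") (auto simp: fjump_def intro!: cInf_greatest cSup_upper bdd_aboveI[of _ b])

lemma fjump_S_in:
  assumes "c \<in> S"
  shows "fjump S c \<in> S"
proof (cases "\<exists>s\<in>S. c < s")
  case False
  then have "Sup S = c" using assms by (intro cSup_eq_maximum) force+
  with False assms show ?thesis by (simp add: fjump_def)
next
  case True
  let ?A = "{s\<in>S. c < s}"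
  have "fjump S c = c \<or> c < fjump S c" using fjump_S_ge[OF assms] by auto
  then show ?thesis
  proof
    assume lt: "c < fjump S c"
    have eq: "fjump S c = Inf ?A" using True by (auto simp: fjump_def)
    have bd: "bdd_below ?A" by (auto intro: bdd_belowI[of _ c])
    have "Inf ?A \<le> s" if "s \<in> S" "c < s" for s using that bd by (intro cInf_lower) auto
    then have "?A = S \<inter> {fjump S c..}" using lt eq by force
    moreover have "closed (S \<inter> {fjump S c..})" by (intro closed_Int closed_S closed_atMost closed_atLeast)
    ultimately have "Inf ?A \<in> ?A" using True bd by (intro closed_contains_Inf) auto
    then show ?thesis by (simp add: eq)
  qed (use assms in simp)
qed

lemma fjump_S_le: "s \<in> S \<Longrightarrow> c < s \<Longrightarrow> fjump S c \<le> s"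
  by (auto simp: fjump_def intro!: cInf_lower bdd_belowI[of _ c])

section \<open>Limits along the delta filter\<close>

lemma delta_filter_eq_at:
  assumes "fjump S c = c"
  shows "delta_filter S c = at c within S"
  by (simp add: delta_filter_def at_within_def assms)

lemma at_left_le_delta_filter:
  assumes "c \<in> S"
  shows "at c within (S \<inter> {..<c}) \<le> delta_filter S c"
  unfolding delta_filter_def at_within_def
  using fjump_S_ge[OF assms] by (intro inf_mono) auto

text \<open>At a right-scattered \<open>c\<close> the filter keeps the point \<open>t = c\<close>
  itself, so a limit along it has to equal the value of the difference quotient at
  \<open>c\<close>.\<close>

lemma principal_le_delta_filter:
  assumes "c \<in> S" "fjump S c \<noteq> c"
  shows "principal {c} \<le> delta_filter S c"
  unfolding delta_filter_def
proof (rule inf_greatest)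
  show "principal {c} \<le> nhds c" by (simp add: le_nhds eventually_principal)
  show "principal {c} \<le> principal (S - {fjump S c})" using assms by simp
qed

lemma has_delta_deriv_scattered:
  assumes "has_delta_deriv S g D c" "c \<in> S" "c < fjump S c"
  shows "D = (g (fjump S c) - g c) / (fjump S c - c)"
proof -
  have "principal {c} \<le> delta_filter S c"
    using assms by (intro principal_le_delta_filter) auto
  then have "((\<lambda>t. (g (fjump S c) - g t) / (fjump S c - t)) \<longlongrightarrow> D) (principal {c})"
    using assms by (auto simp: has_delta_deriv_def intro: tendsto_mono)
  moreover have "((\<lambda>t. (g (fjump S c) - g t) / (fjump S c - t))
      \<longlongrightarrow> (g (fjump S c) - g c) / (fjump S c - c)) (principal {c})"
    by (rule tendsto_eventually) (simp add: eventually_principal)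
  ultimately show ?thesis by (intro tendsto_unique) (auto simp: trivial_limit_def eventually_principal)
qed

text \<open>This is what \<open>ts_kappa\<close> is for: it makes delta derivatives unique. If
  \<open>c\<close> is its own forward jump, points of \<open>S\<close> approach it from the right
  when \<open>c < b\<close>, and from the left when \<open>c = b\<close>, because a left-scattered
  \<open>b\<close> has been removed.\<close>

lemma delta_filter_nontrivial:
  assumes "c \<in> ts_kappa S"
  shows "delta_filter S c \<noteq> bot"
proof -
  have cS: "c \<in> S" using assms by (simp add: ts_kappa_def)
  show ?thesis
  proof (cases "fjump S c = c")
    case False
    have "principal {c} \<le> delta_filter S c"
      using False cS by (intro principal_le_delta_filter)
    then show ?thesis by (metis bot.extremum_uniqueI insert_not_empty principal_eq_bot_iff)
  next
    case True
    have "c islimpt S"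
      unfolding islimpt_approachable
    proof (intro allI impI)
      fix e :: real assume e: "e > 0"
      show "\<exists>x'\<in>S. x' \<noteq> c \<and> dist x' c < e"
      proof (cases "c < b")
        case True
        then have ex: "\<exists>s\<in>S. c < s" using bT ab by auto
        then have "Inf {s\<in>S. c < s} < c + e" using \<open>fjump S c = c\<close> e by (simp add: fjump_def)
        then obtain s where "s \<in> S" "c < s" "s < c + e"
          using ex by (subst (asm) cInf_less_iff) (auto intro: bdd_belowI[of _ c])
        then show ?thesis by (intro bexI[of _ s]) (auto simp: dist_real_def)
      next
        case False
        then have cb: "c = b" using cS by auto
        then have "\<not> bjump S b < b" using assms by (auto simp: kappa_S split: if_splits)
        moreover have ex: "\<exists>s\<in>S. s < b" using aT ab by auto
        ultimately have lt: "b - e < Sup {s\<in>S. s < b}" using e by (simp add: bjump_def)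
        obtain s where "s \<in> {s\<in>S. s < b}" "b - e < s"
          using less_cSupE[OF lt] ex by blast
        then show ?thesis using cb by (intro bexI[of _ s]) (auto simp: dist_real_def)
      qed
    qed
    then show ?thesis
      by (simp add: delta_filter_eq_at[OF True] trivial_limit_within)
  qed
qed

lemma delta_deriv_eq:
  assumes "has_delta_deriv S g D c" "c \<in> ts_kappa S"
  shows "delta_deriv S g c = D"
  unfolding delta_deriv_def
proof (rule the_equality[where P = "\<lambda>D. has_delta_deriv S g D c"])
  show "D' = D" if "has_delta_deriv S g D' c" for D'
    using that assms(1) delta_filter_nontrivial[OF assms(2)] unfolding has_delta_deriv_def
    by (intro tendsto_unique)
qed fact

text \<open>Solving the difference quotient for \<open>g t\<close> gives the left limit
  \<open>g \<sigma> - D * (\<sigma> - c)\<close>, with \<sigma> the forward jump of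
  \<open>c\<close>. This is \<open>g c\<close>, trivially if \<open>\<sigma> = c\<close> and by the
  quotient formula for \<open>D\<close> otherwise.\<close>

lemma has_delta_deriv_left_continuous:
  assumes "has_delta_deriv S g D c" "c \<in> S"
  shows "(g \<longlongrightarrow> g c) (at c within (S \<inter> {..<c}))"
proof -
  let ?\<sigma> = "fjump S c" and ?F = "at c within (S \<inter> {..<c})"
  have "((\<lambda>t. (g ?\<sigma> - g t) / (?\<sigma> - t)) \<longlongrightarrow> D) ?F"
    using assms at_left_le_delta_filter by (auto simp: has_delta_deriv_def intro: tendsto_mono)
  then have "((\<lambda>t. g ?\<sigma> - (g ?\<sigma> - g t) / (?\<sigma> - t) * (?\<sigma> - t)) \<longlongrightarrow> g ?\<sigma> - D * (?\<sigma> - c)) ?F"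
    by (intro tendsto_intros) auto
  also have "g ?\<sigma> - D * (?\<sigma> - c) = g c"
    using has_delta_deriv_scattered[OF assms] fjump_S_ge[OF assms(2)]
    by (cases "c < ?\<sigma>") auto
  finally show ?thesis
  proof (rule Lim_transform_eventually)
    have "\<forall>\<^sub>F t in ?F. t < c" by (auto simp: eventually_at_filter)
    then show "\<forall>\<^sub>F t in ?F. g ?\<sigma> - (g ?\<sigma> - g t) / (?\<sigma> - t) * (?\<sigma> - t) = g t"
      by eventually_elim (use fjump_S_ge[OF assms(2)] in auto)
  qed
qed

lemma right_dense_kappa:
  assumes c: "c \<in> S" and e: "\<And>e. e > 0 \<Longrightarrow> \<exists>s\<in>S. c < s \<and> s < c + e"
  shows "right_dense (ts_kappa S) c" "fjump S c = c"
proof -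
  have cb: "c < b" using e[of 1] by auto
  show "right_dense (ts_kappa S) c"
  proof (rule right_denseI)
    show "c \<in> ts_kappa S" using c cb Ico_subset_kappa by auto
    fix d :: real assume "d > 0"
    \<comment> \<open>Staying within distance \<open>b - c\<close> keeps \<open>s\<close> below
      \<open>b\<close>, hence inside \<open>ts_kappa S\<close>.\<close>
    with cb e[of "min d (b - c)"] obtain s where "s \<in> S" "c < s" "s < c + min d (b - c)" by auto
    then show "\<exists>s\<in>ts_kappa S. c < s \<and> s < c + d"
      using Ico_subset_kappa by (intro bexI[of _ s]) auto
  qed (use closed_kappa a_in_kappa bdd_kappa in auto)
  have "right_dense S c"
    using c e closed_S by (intro right_denseI) (auto intro: bdd_belowI[of _ a])
  then show "fjump S c = c" by (simp add: right_dense_def)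
qed

section \<open>The growth bound by real induction\<close>

lemma nn_integral_extend_ge:
  assumes w[measurable]: "w \<in> borel_measurable borel" and uv: "u \<in> S" "v \<in> S" "u \<le> v"
    and m: "\<And>s. s \<in> T \<Longrightarrow> u \<le> s \<Longrightarrow> s < v \<Longrightarrow> ennreal m \<le> w s" "0 \<le> m"
  shows "(\<integral>\<^sup>+s\<in>T \<inter> {a..<u}. w s \<partial>delta_measure T) + ennreal (m * (v - u))
    \<le> (\<integral>\<^sup>+s\<in>T \<inter> {a..<v}. w s \<partial>delta_measure T)"
proof -
  let ?M = "delta_measure T"
  have [measurable_cong]: "sets ?M = sets borel" by (simp add: delta_measure_def)
  have [measurable]: "T \<in> sets borel" using T by (auto simp: time_scale_def)
  have "ennreal (m * (v - u)) = (\<integral>\<^sup>+s. ennreal m * indicator (T \<inter> {u..<v}) s \<partial>?M)"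
    using uv m sets_S by (simp add: nn_integral_cmult_indicator emeasure_delta_measure[OF T] ennreal_mult)
  also have "\<dots> \<le> (\<integral>\<^sup>+s\<in>T \<inter> {u..<v}. w s \<partial>?M)"
    using m by (intro nn_integral_mono) (auto simp: indicator_def)
  finally have "(\<integral>\<^sup>+s\<in>T \<inter> {a..<u}. w s \<partial>?M) + ennreal (m * (v - u))
      \<le> (\<integral>\<^sup>+s\<in>T \<inter> {a..<u}. w s \<partial>?M) + (\<integral>\<^sup>+s\<in>T \<inter> {u..<v}. w s \<partial>?M)"
    by (rule add_left_mono)
  also have "\<dots> = (\<integral>\<^sup>+s. w s * indicator (T \<inter> {a..<u}) s + w s * indicator (T \<inter> {u..<v}) s \<partial>?M)"
    by (intro nn_integral_add[symmetric]) measurable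
  also have "\<dots> = (\<integral>\<^sup>+s\<in>T \<inter> {a..<v}. w s \<partial>?M)"
    using uv by (intro nn_integral_cong) (auto simp: indicator_def)
  finally show ?thesis .
qed

text \<open>Real induction on \<open>S\<close>: the bound with slack \<open>\<epsilon> * (t - a)\<close> cannot fail first at a point \<open>c\<close> (by the
  left limit or the jump into \<open>c\<close>), nor at points decreasing to \<open>c\<close> (by the derivative at \<open>c\<close>).\<close>

lemma abs_le_nn_integral_delta_deriv:
  assumes der: "\<And>t. t \<in> ts_kappa S \<Longrightarrow> has_delta_deriv S \<phi> (\<psi> t) t"
    and rd: "rd_continuous_on (ts_kappa S) \<psi>"
    and \<phi>a: "\<phi> a = 0" and t0: "t0 \<in> S"
  shows "ennreal \<bar>\<phi> t0\<bar> \<le> (\<integral>\<^sup>+s\<in>T \<inter> {a..<t0}. ennreal \<bar>\<psi> s\<bar> \<partial>delta_measure T)"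
proof -
  have Kne: "ts_kappa S \<noteq> {}" using a_in_kappa by auto
  \<comment> \<open>Nothing is known about \<psi> outside \<open>ts_kappa S\<close>. The floored
    version is Borel on the whole line and agrees with \<psi> on \<open>ts_kappa S\<close>.\<close>
  define w where "w s = ennreal \<bar>\<psi> (ts_floor (ts_kappa S) s)\<bar>" for s
  have [measurable]: "w \<in> borel_measurable borel"
    unfolding w_def using borel_measurable_rd_continuous[OF closed_kappa Kne bdd_kappa rd] by measurable
  have w: "w s = ennreal \<bar>\<psi> s\<bar>" if "s \<in> ts_kappa S" for s
    using ts_floor_id[OF closed_kappa Kne bdd_kappa that] by (simp add: w_def)
  define V where "V t = (\<integral>\<^sup>+s\<in>T \<inter> {a..<t}. w s \<partial>delta_measure T)" for t
  have Vmono: "V s \<le> V t" if "s \<le> t" for s t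
    unfolding V_def using that by (intro nn_integral_mono) (auto simp: indicator_def)
  have "ennreal \<bar>\<phi> t0\<bar> \<le> V t0 + ennreal (\<epsilon> * (t0 - a))" if \<epsilon>: "\<epsilon> > 0" for \<epsilon>
  proof (rule ccontr)
    define P where "P t \<longleftrightarrow> ennreal \<bar>\<phi> t\<bar> \<le> V t + ennreal (\<epsilon> * (t - a))" for t
    define B where "B = {s\<in>S. \<not> P s}"
    define c where "c = Inf B"
    have bdB: "bdd_below B" by (auto simp: B_def intro: bdd_belowI[of _ a])
    assume "\<not> ennreal \<bar>\<phi> t0\<bar> \<le> V t0 + ennreal (\<epsilon> * (t0 - a))"
    then have t0B: "t0 \<in> B" using t0 by (simp add: B_def P_def)
    then have "c \<in> closure B" unfolding c_def using bdB by (intro closure_contains_Inf) auto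
    moreover have "closure B \<subseteq> S" using closed_S by (intro closure_minimal) (auto simp: B_def)
    ultimately have cS: "c \<in> S" by auto
    have before: "P s" if "s \<in> S" "s < c" for s
    proof (rule ccontr)
      assume "\<not> P s"
      then have "c \<le> s" unfolding c_def using that bdB by (intro cInf_lower) (auto simp: B_def)
      with that show False by simp
    qed
    have Pc: "P c"
    proof (cases "c = a")
      case True
      then show ?thesis by (simp add: P_def \<phi>a)
    next
      case False
      then have ac: "a < c" using cS by auto
      have ex: "\<exists>s\<in>S. s < c" using aT ab ac by auto
      have "bjump S c \<le> c" using ex by (auto simp: bjump_def intro!: cSup_least)
      then consider "bjump S c < c" | "bjump S c = c" by linarith
      then show ?thesis
      proof cases
        case 1
        \<comment> \<open>\<open>c\<close> is left-scattered. The derivative at its predecessor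
          \<open>r\<close> is a plain quotient, so
          \<open>\<phi> c = \<phi> r + \<psi> r * (c - r)\<close>; the integral gains the matching
          amount from \<open>r\<close>, the only point of \<open>T\<close> in the interval from
          \<open>r\<close> up to, but excluding, \<open>c\<close>.\<close>
        define r where "r = bjump S c"
        from ex 1 cS have rS: "r \<in> S" unfolding r_def by (intro bjump_S_in)
        have rc: "r < c" using 1 by (simp add: r_def)
        have gap: "s \<le> r" if "s \<in> S" "s < c" for s
          using le_bjump_S[OF that] by (simp add: r_def)
        have exr: "\<exists>s\<in>S. r < s" using rc cS by auto
        have "fjump S r = c"
        proof (rule antisym)
          show "fjump S r \<le> c" using cS rc by (rule fjump_S_le)
          show "c \<le> fjump S r"
            using exr gap by (force simp: fjump_def intro!: cInf_greatest)
        qed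
        moreover have rK: "r \<in> ts_kappa S" using rS rc cS Ico_subset_kappa by auto
        ultimately have "\<psi> r = (\<phi> c - \<phi> r) / (c - r)"
          using has_delta_deriv_scattered[OF der[OF rK] rS] rc by simp
        then have "\<phi> c = \<phi> r + \<psi> r * (c - r)" using rc by (simp add: field_simps)
        then have "\<bar>\<phi> c\<bar> \<le> \<bar>\<phi> r\<bar> + \<bar>\<psi> r\<bar> * (c - r)"
          using rc abs_triangle_ineq[of "\<phi> r" "\<psi> r * (c - r)"] by (simp add: abs_mult)
        then have "ennreal \<bar>\<phi> c\<bar> \<le> ennreal \<bar>\<phi> r\<bar> + ennreal (\<bar>\<psi> r\<bar> * (c - r))"
          using rc by (simp flip: ennreal_plus)
        also have "\<dots> \<le> V r + ennreal (\<epsilon> * (r - a)) + ennreal (\<bar>\<psi> r\<bar> * (c - r))"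
          using before[OF rS rc] by (simp add: P_def add_right_mono)
        also have "\<dots> = (V r + ennreal (\<bar>\<psi> r\<bar> * (c - r))) + ennreal (\<epsilon> * (r - a))"
          by (simp add: ac_simps)
        also have "\<dots> \<le> V c + ennreal (\<epsilon> * (c - a))"
        proof (rule add_mono)
          show "V r + ennreal (\<bar>\<psi> r\<bar> * (c - r)) \<le> V c"
            unfolding V_def
          proof (rule nn_integral_extend_ge)
            fix s assume "s \<in> T" "r \<le> s" "s < c"
            then have "s = r" using gap[of s] rS cS by auto
            then show "ennreal \<bar>\<psi> r\<bar> \<le> w s" using w[OF rK] by simp
          qed (use rS cS rc in auto)
          show "ennreal (\<epsilon> * (r - a)) \<le> ennreal (\<epsilon> * (c - a))"
            using \<epsilon> rc by (intro ennreal_leI mult_left_mono) auto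
        qed
        finally show ?thesis by (simp add: P_def)
      next
        case 2
        \<comment> \<open>\<open>c\<close> is left-dense, so it survives in
          \<open>ts_kappa S\<close> even if \<open>c = b\<close>; hence \<phi> is
          delta-differentiable and left-continuous there.\<close>
        have "c \<in> ts_kappa S"
          using cS 2 by (auto simp: kappa_S)
        then have lim: "(\<phi> \<longlongrightarrow> \<phi> c) (at c within (S \<inter> {..<c}))"
          using der cS by (intro has_delta_deriv_left_continuous)
        have "c islimpt (S \<inter> {..<c})"
          unfolding islimpt_approachable
        proof (intro allI impI)
          fix e :: real assume "e > 0"
          then have "c - e < Sup {s\<in>S. s < c}" using 2 ex by (simp add: bjump_def)
          then obtain s where "s \<in> S" "s < c" "c - e < s"
            using ex by (subst (asm) less_cSup_iff) (auto intro: bdd_aboveI[of _ c])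
          then show "\<exists>x'\<in>S \<inter> {..<c}. x' \<noteq> c \<and> dist x' c < e"
            by (intro bexI[of _ s]) (auto simp: dist_real_def)
        qed
        then have nt: "at c within (S \<inter> {..<c}) \<noteq> bot" by (simp add: trivial_limit_within)
        have "((\<lambda>t. ennreal \<bar>\<phi> t\<bar>) \<longlongrightarrow> ennreal \<bar>\<phi> c\<bar>) (at c within (S \<inter> {..<c}))"
          using lim by (intro tendsto_intros)
        moreover have "\<forall>\<^sub>F t in at c within (S \<inter> {..<c}). ennreal \<bar>\<phi> t\<bar> \<le> V c + ennreal (\<epsilon> * (c - a))"
          unfolding eventually_at_filter
        proof (intro always_eventually allI impI)
          fix t assume t: "t \<in> S \<inter> {..<c}"
          then have "ennreal \<bar>\<phi> t\<bar> \<le> V t + ennreal (\<epsilon> * (t - a))" using before[of t] by (auto simp: P_def)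
          also have "\<dots> \<le> V c + ennreal (\<epsilon> * (c - a))"
            using t \<epsilon> by (intro add_mono Vmono ennreal_leI mult_left_mono) auto
          finally show "ennreal \<bar>\<phi> t\<bar> \<le> V c + ennreal (\<epsilon> * (c - a))" .
        qed
        ultimately show ?thesis unfolding P_def using nt by (intro tendsto_upperbound)
      qed
    qed
    \<comment> \<open>Since \<open>P c\<close> holds, the infimum of \<open>B\<close> is not
      attained, and failures accumulate at \<open>c\<close> from the right.\<close>
    have nearB: "\<exists>s\<in>B. c < s \<and> s < c + e" if "e > 0" for e
    proof -
      have "Inf B < c + e" using that by (simp add: c_def)
      then obtain s where s: "s \<in> B" "s < c + e"
        using t0B bdB by (subst (asm) cInf_less_iff) auto
      moreover have "c \<le> s" unfolding c_def using s bdB by (intro cInf_lower)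
      moreover have "c \<noteq> s" using s Pc by (auto simp: B_def)
      ultimately have "s \<in> B \<and> c < s \<and> s < c + e" by linarith
      then show ?thesis by blast
    qed
    then have "\<exists>s\<in>S. c < s \<and> s < c + e" if "e > 0" for e
      using that unfolding B_def by blast
    note rdc = right_dense_kappa[OF cS this]
    have cK: "c \<in> ts_kappa S" using rdc(1) by (simp add: right_dense_def)
    define D where "D = \<psi> c"
    have "((\<lambda>t. (\<phi> c - \<phi> t) / (c - t)) \<longlongrightarrow> D) (at c within S)"
      using der[OF cK] by (simp add: has_delta_deriv_def delta_filter_eq_at[OF rdc(2)] rdc(2) D_def)
    then have "\<forall>\<^sub>F t in at c within S. dist ((\<phi> c - \<phi> t) / (c - t)) D < \<epsilon> / 2"
      using \<epsilon> by (intro tendstoD) auto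
    then obtain d1 where d1: "d1 > 0"
      "\<And>t. t \<in> S \<Longrightarrow> t \<noteq> c \<Longrightarrow> dist t c < d1 \<Longrightarrow> dist ((\<phi> c - \<phi> t) / (c - t)) D < \<epsilon> / 2"
      by (auto simp: eventually_at)
    have "(\<psi> \<longlongrightarrow> D) (at c within ts_kappa S)"
      using rd rdc(1) by (auto simp: rd_continuous_on_def continuous_within D_def)
    then have "\<forall>\<^sub>F t in at c within ts_kappa S. dist (\<psi> t) D < \<epsilon> / 2"
      using \<epsilon> by (intro tendstoD) auto
    then obtain d2 where d2: "d2 > 0"
      "\<And>t. t \<in> ts_kappa S \<Longrightarrow> t \<noteq> c \<Longrightarrow> dist t c < d2 \<Longrightarrow> dist (\<psi> t) D < \<epsilon> / 2"
      by (auto simp: eventually_at)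
    obtain s where s: "s \<in> B" "c < s" "s < c + min d1 d2"
      using nearB[of "min d1 d2"] d1 d2 by auto
    have sS: "s \<in> S" using s by (simp add: B_def)
    define q where "q = (\<phi> c - \<phi> s) / (c - s)"
    have "dist q D < \<epsilon> / 2"
      unfolding q_def using s sS by (intro d1) (auto simp: dist_real_def)
    then have "\<bar>q\<bar> \<le> \<bar>D\<bar> + \<epsilon> / 2" unfolding dist_real_def by linarith
    then have "\<bar>\<phi> c - \<phi> s\<bar> \<le> (\<bar>D\<bar> + \<epsilon> / 2) * (s - c)"
      using s by (simp add: q_def abs_divide field_simps)
    \<comment> \<open>\<open>m\<close> is a lower bound for the absolute value of \<psi> just to the
      right of \<open>c\<close>, cut off at 0. The increment of \<phi> per unit length is at most
      \<open>\<bar>D\<bar> + \<epsilon> / 2\<close>, which is at most \<open>m + \<epsilon>\<close>: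
      the slack absorbs both errors of size \<open>\<epsilon> / 2\<close>.\<close>
    define m where "m = max 0 (\<bar>D\<bar> - \<epsilon> / 2)"
    have "(\<bar>D\<bar> + \<epsilon> / 2) * (s - c) \<le> (m + \<epsilon>) * (s - c)"
      using s \<epsilon> by (intro mult_right_mono) (auto simp: m_def)
    with \<open>\<bar>\<phi> c - \<phi> s\<bar> \<le> (\<bar>D\<bar> + \<epsilon> / 2) * (s - c)\<close>
    have "\<bar>\<phi> s\<bar> \<le> \<bar>\<phi> c\<bar> + m * (s - c) + \<epsilon> * (s - c)" by (simp add: algebra_simps)
    moreover have "0 \<le> m" by (simp add: m_def)
    ultimately have "ennreal \<bar>\<phi> s\<bar> \<le> ennreal \<bar>\<phi> c\<bar> + ennreal (m * (s - c)) + ennreal (\<epsilon> * (s - c))"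
      using s \<epsilon> by (simp flip: ennreal_plus)
    also have "\<dots> \<le> V c + ennreal (\<epsilon> * (c - a)) + ennreal (m * (s - c)) + ennreal (\<epsilon> * (s - c))"
      using Pc by (simp add: P_def add_right_mono)
    also have "\<dots> = (V c + ennreal (m * (s - c))) + (ennreal (\<epsilon> * (c - a)) + ennreal (\<epsilon> * (s - c)))"
      by (simp add: ac_simps)
    also have "ennreal (\<epsilon> * (c - a)) + ennreal (\<epsilon> * (s - c)) = ennreal (\<epsilon> * (s - a))"
    proof -
      have "\<epsilon> * (c - a) + \<epsilon> * (s - c) = \<epsilon> * (s - a)" by (simp add: algebra_simps)
      moreover have "0 \<le> \<epsilon> * (c - a)" "0 \<le> \<epsilon> * (s - c)" using \<epsilon> s cS by auto
      ultimately show ?thesis by (metis ennreal_plus)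
    qed
    also have "V c + ennreal (m * (s - c)) \<le> V s"
      unfolding V_def
    proof (rule nn_integral_extend_ge)
      fix u assume u: "u \<in> T" "c \<le> u" "u < s"
      then have uK: "u \<in> ts_kappa S" using Ico_subset_kappa sS cS by auto
      have "dist (\<psi> u) D < \<epsilon> / 2"
        using u s d2(2)[OF uK] \<epsilon> by (cases "u = c") (auto simp: D_def dist_real_def)
      then have "\<bar>D\<bar> - \<epsilon> / 2 \<le> \<bar>\<psi> u\<bar>" unfolding dist_real_def by linarith
      then have "m \<le> \<bar>\<psi> u\<bar>" by (simp add: m_def)
      then show "ennreal m \<le> w u" using w[OF uK] by (simp add: ennreal_leI)
    qed (use cS sS s \<open>0 \<le> m\<close> in auto)
    finally have "P s" by (simp add: P_def add_right_mono)
    with s show False by (simp add: B_def)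
  qed
  note * = this
  have "ennreal \<bar>\<phi> t0\<bar> \<le> V t0"
  proof (rule ennreal_le_epsilon)
    fix e :: real assume e: "0 < e"
    show "ennreal \<bar>\<phi> t0\<bar> \<le> V t0 + ennreal e"
    proof (cases "t0 = a")
      case False
      then have "t0 - a > 0" using t0 by auto
      then show ?thesis using *[of "e / (t0 - a)"] e by simp
    qed (simp add: \<phi>a)
  qed
  also have "V t0 = (\<integral>\<^sup>+s\<in>T \<inter> {a..<t0}. ennreal \<bar>\<psi> s\<bar> \<partial>delta_measure T)"
    unfolding V_def using w Ico_subset_kappa t0
    by (intro nn_integral_cong) (auto simp: indicator_def subset_iff)
  finally show ?thesis .
qed

end

section \<open>Iterated integrals with the first variable outermost\<close>

text \<open>\<open>delta_integral\<close> is defined by recursion on the innermost variable. The inner integrals over the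
  variables \<open>j, \<dots>, j + l - 1\<close> give a recursion in the other direction without interchanging any
  integrals.\<close>

primrec inner_nn_integral ::
  "(nat \<Rightarrow> real set) \<Rightarrow> (nat \<Rightarrow> real) \<Rightarrow> (nat \<Rightarrow> real) \<Rightarrow> nat \<Rightarrow> nat \<Rightarrow> ((nat \<Rightarrow> real) \<Rightarrow> ennreal)
     \<Rightarrow> (nat \<Rightarrow> real) \<Rightarrow> ennreal"
where
  "inner_nn_integral T a b 0 = (\<lambda>j g x. g x)"
| "inner_nn_integral T a b (Suc l) = (\<lambda>j g x. set_nn_integral (delta_measure (T j)) (T j \<inter> {a j..<b j})
      (\<lambda>t. inner_nn_integral T a b l (Suc j) g (x(j := t))))"

primrec inner_integral ::
  "(nat \<Rightarrow> real set) \<Rightarrow> (nat \<Rightarrow> real) \<Rightarrow> (nat \<Rightarrow> real) \<Rightarrow> nat \<Rightarrow> nat \<Rightarrow> ((nat \<Rightarrow> real) \<Rightarrow> real)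
     \<Rightarrow> (nat \<Rightarrow> real) \<Rightarrow> real"
where
  "inner_integral T a b 0 = (\<lambda>j g x. g x)"
| "inner_integral T a b (Suc l) = (\<lambda>j g x. set_lebesgue_integral (delta_measure (T j))
      (T j \<inter> {a j..<b j}) (\<lambda>t. inner_integral T a b l (Suc j) g (x(j := t))))"

lemma delta_nn_integral_inner:
  "delta_nn_integral T a b j (inner_nn_integral T a b l j g)
    = inner_nn_integral T a b (j + l) 0 g (\<lambda>_. undefined)"
proof (induction j arbitrary: l)
  case (Suc j)
  show ?case using Suc[of "Suc l"] by simp
qed simp

lemma delta_nn_integral_eq_inner:
  "delta_nn_integral T a b n g = inner_nn_integral T a b n 0 g (\<lambda>_. undefined)"
  using delta_nn_integral_inner[of T a b n 0 g] by simp

lemma delta_integral_inner: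
  "delta_integral T a b j (inner_integral T a b l j g)
    = inner_integral T a b (j + l) 0 g (\<lambda>_. undefined)"
proof (induction j arbitrary: l)
  case (Suc j)
  show ?case using Suc[of "Suc l"] by simp
qed simp

lemma delta_integral_eq_inner:
  "delta_integral T a b n g = inner_integral T a b n 0 g (\<lambda>_. undefined)"
  using delta_integral_inner[of T a b n 0 g] by simp

text \<open>\<open>enn2real\<close> sends infinity to 0, but a finite integral confines that value
  to a null set.\<close>

lemma integrable_enn2real:
  assumes [measurable]: "\<phi> \<in> borel_measurable M" and fin: "integral\<^sup>N M \<phi> < \<infinity>"
  shows "integrable M (\<lambda>x. enn2real (\<phi> x))"
    and "(\<integral>x. enn2real (\<phi> x) \<partial>M) = enn2real (integral\<^sup>N M \<phi>)"
proof -
  have "AE x in M. \<phi> x \<noteq> \<infinity>" using fin by (intro nn_integral_noteq_infinite) auto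
  then have eq: "(\<integral>\<^sup>+x. ennreal (enn2real (\<phi> x)) \<partial>M) = integral\<^sup>N M \<phi>"
    by (intro nn_integral_cong_AE) (auto simp: less_top)
  show "integrable M (\<lambda>x. enn2real (\<phi> x))"
    using fin eq by (intro integrableI_nonneg) auto
  show "(\<integral>x. enn2real (\<phi> x) \<partial>M) = enn2real (integral\<^sup>N M \<phi>)"
    by (subst integral_eq_nn_integral) (auto simp: eq)
qed

text \<open>The coordinates from \<open>j\<close> on are left free because the inner integrals
  overwrite them. In particular the base point \<open>\<lambda>_. undefined\<close> belongs to the
  set for \<open>j = 0\<close>.\<close>

definition initial_box ::
  "(nat \<Rightarrow> real set) \<Rightarrow> (nat \<Rightarrow> real) \<Rightarrow> (nat \<Rightarrow> real) \<Rightarrow> nat \<Rightarrow> nat \<Rightarrow> (nat \<Rightarrow> real) set" where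
  "initial_box T a b n j = {x \<in> extensional {..<n}. \<forall>i<j. x i \<in> T i \<inter> {a i..<b i}}"

lemma initial_box_upd:
  "x \<in> initial_box T a b n j \<Longrightarrow> j < n \<Longrightarrow> t \<in> T j \<inter> {a j..<b j}
    \<Longrightarrow> x(j := t) \<in> initial_box T a b n (Suc j)"
  by (auto simp: initial_box_def extensional_def less_Suc_eq)

locale ts_intervals =
  fixes n :: nat and T :: "nat \<Rightarrow> real set" and a b :: "nat \<Rightarrow> real"
  assumes interval: "\<And>j. j < n \<Longrightarrow> ts_interval (T j) (a j) (b j)"
begin

abbreviation "\<mu> j \<equiv> delta_measure (T j)"
abbreviation "J j \<equiv> T j \<inter> {a j..<b j}"
abbreviation "S \<equiv> ts_box T a b"
abbreviation "product_borel \<equiv> Pi\<^sub>M {..<n} (\<lambda>_. borel :: real measure)"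
abbreviation "Q \<equiv> initial_box T a b n"

lemma sigma_finite_delta: "j < n \<Longrightarrow> sigma_finite_measure (\<mu> j)"
  unfolding delta_measure_def
  using interval[of j] fjump_mono fjump_right_cont
  by (intro sigma_finite_interval_measure) (auto simp: ts_interval_def)

lemma sets_delta: "sets (\<mu> j) = sets borel"
  by (simp add: delta_measure_def)

lemma sets_J: "j < n \<Longrightarrow> J j \<in> sets borel"
  using interval[of j] by (auto simp: ts_interval_def time_scale_def)

lemma measurable_upd:
  assumes "j < n"
  shows "(\<lambda>p. (fst p)(j := snd p)) \<in> product_borel \<Otimes>\<^sub>M \<mu> j \<rightarrow>\<^sub>M product_borel"
proof (rule measurable_fun_upd[where J = "{..<n}"])
  show "snd \<in> borel_measurable (product_borel \<Otimes>\<^sub>M \<mu> j)"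
    using measurable_snd[of product_borel "\<mu> j"]
    by (simp only: measurable_cong_sets[OF refl sets_delta])
qed (use assms in auto)

lemma measurable_slice:
  assumes "g \<in> borel_measurable product_borel" "x \<in> extensional {..<n}" "j < n"
  shows "(\<lambda>t. g (x(j := t))) \<in> borel_measurable (\<mu> j)"
proof -
  have "(\<lambda>t. x(j := t)) \<in> borel \<rightarrow>\<^sub>M product_borel"
    using assms by (intro measurable_fun_upd[where J = "{..<n}"]) (auto simp: space_PiM PiE_def)
  then have "(\<lambda>t. g (x(j := t))) \<in> borel_measurable borel"
    using assms(1) by (rule measurable_compose)
  then show ?thesis by (simp add: measurable_cong_sets[OF sets_delta refl])
qed

lemma borel_measurable_inner_nn_integral:
  assumes g: "g \<in> borel_measurable product_borel" and "j + l \<le> n"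
  shows "inner_nn_integral T a b l j g \<in> borel_measurable product_borel"
  using assms(2)
proof (induction l arbitrary: j)
  case (Suc l)
  then have j: "j < n" by simp
  interpret sigma_finite_measure "\<mu> j" using j by (rule sigma_finite_delta)
  have [measurable]: "inner_nn_integral T a b l (Suc j) g \<in> borel_measurable product_borel"
    using Suc by simp
  have [measurable]: "J j \<in> sets (\<mu> j)" using sets_J[OF j] by (simp add: sets_delta)
  note [measurable] = measurable_upd[OF j]
  have "(\<lambda>p. inner_nn_integral T a b l (Suc j) g ((fst p)(j := snd p)) * indicator (J j) (snd p))
      \<in> borel_measurable (product_borel \<Otimes>\<^sub>M \<mu> j)"
    by measurable
  then show ?case by (simp add: borel_measurable_nn_integral case_prod_unfold)
qed (use g in simp)

lemma borel_measurable_inner_integral: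
  assumes g: "g \<in> borel_measurable product_borel" and "j + l \<le> n"
  shows "inner_integral T a b l j g \<in> borel_measurable product_borel"
  using assms(2)
proof (induction l arbitrary: j)
  case (Suc l)
  then have j: "j < n" by simp
  interpret sigma_finite_measure "\<mu> j" using j by (rule sigma_finite_delta)
  have [measurable]: "inner_integral T a b l (Suc j) g \<in> borel_measurable product_borel"
    using Suc by simp
  have [measurable]: "J j \<in> sets (\<mu> j)" using sets_J[OF j] by (simp add: sets_delta)
  note [measurable] = measurable_upd[OF j]
  have "(\<lambda>p. indicator (J j) (snd p) *\<^sub>R inner_integral T a b l (Suc j) g ((fst p)(j := snd p)))
      \<in> borel_measurable (product_borel \<Otimes>\<^sub>M \<mu> j)"
    by measurable
  then show ?case
    by (simp add: set_lebesgue_integral_def borel_measurable_lebesgue_integral case_prod_unfold)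
qed (use g in simp)

lemma inner_nn_integral_cong:
  assumes "\<And>y. y \<in> Q n \<Longrightarrow> g y = g' y" "x \<in> Q j" "j + l = n"
  shows "inner_nn_integral T a b l j g x = inner_nn_integral T a b l j g' x"
  using assms(2,3)
proof (induction l arbitrary: j x)
  case (Suc l)
  have "inner_nn_integral T a b l (Suc j) g (x(j := t)) = inner_nn_integral T a b l (Suc j) g' (x(j := t))"
    if "t \<in> J j" for t
    by (rule Suc.IH) (use initial_box_upd[OF Suc.prems(1) _ that] Suc.prems(2) in \<open>simp_all del: fun_upd_apply\<close>)
  then show ?case by (auto intro!: nn_integral_cong simp: indicator_def)
qed (use assms(1) in simp)

lemma inner_integral_cong:
  assumes "\<And>y. y \<in> Q n \<Longrightarrow> g y = g' y" "x \<in> Q j" "j + l = n"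
  shows "inner_integral T a b l j g x = inner_integral T a b l j g' x"
  using assms(2,3)
proof (induction l arbitrary: j x)
  case (Suc l)
  have "inner_integral T a b l (Suc j) g (x(j := t)) = inner_integral T a b l (Suc j) g' (x(j := t))"
    if "t \<in> J j" for t
    by (rule Suc.IH) (use initial_box_upd[OF Suc.prems(1) _ that] Suc.prems(2) in \<open>simp_all del: fun_upd_apply\<close>)
  then show ?case
    by (auto intro!: Bochner_Integration.integral_cong simp: indicator_def set_lebesgue_integral_def)
qed (use assms(1) in simp)

text \<open>The coordinates from \<open>j\<close> on are bound by the integrals. This allows the
  later coordinates of a point to be replaced by those of the base point.\<close>

lemma inner_nn_integral_depends:
  assumes "x \<in> extensional {..<n}" "y \<in> extensional {..<n}" "\<And>i. i < j \<Longrightarrow> x i = y i" "j + l = n"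
  shows "inner_nn_integral T a b l j g x = inner_nn_integral T a b l j g y"
  using assms
proof (induction l arbitrary: j x y)
  case 0
  then have "x = y" by (intro extensionalityI) auto
  then show ?case by simp
next
  case (Suc l)
  have "inner_nn_integral T a b l (Suc j) g (x(j := t)) = inner_nn_integral T a b l (Suc j) g (y(j := t))" for t
    using Suc.prems by (intro Suc.IH) (auto simp: extensional_def)
  then show ?case by simp
qed

text \<open>The two recursions can differ only on slices where the non-negative integral is infinite
  and the Bochner integral has its default value. Finiteness at the current level makes these slices
  null, so the induction hypothesis applies almost everywhere.\<close>

lemma inner_integral_eq_nn:
  assumes g: "g \<in> borel_measurable product_borel" "\<And>y. 0 \<le> g y"
    and x: "x \<in> extensional {..<n}" and jl: "j + l = n"
    and fin: "inner_nn_integral T a b l j (\<lambda>y. ennreal (g y)) x < \<infinity>"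
  shows "inner_integral T a b l j g x = enn2real (inner_nn_integral T a b l j (\<lambda>y. ennreal (g y)) x)"
  using x jl fin
proof (induction l arbitrary: j x)
  case (Suc l)
  then have j: "j < n" by simp
  let ?g = "\<lambda>y. ennreal (g y)"
  define \<phi> where "\<phi> = (\<lambda>t. inner_nn_integral T a b l (Suc j) ?g (x(j := t)) * indicator (J j) t)"
  have [measurable]: "J j \<in> sets (\<mu> j)" using sets_J[OF j] by (simp add: sets_delta)
  have [measurable]: "(\<lambda>t. inner_nn_integral T a b l (Suc j) ?g (x(j := t))) \<in> borel_measurable (\<mu> j)"
    "(\<lambda>t. inner_integral T a b l (Suc j) g (x(j := t))) \<in> borel_measurable (\<mu> j)"
    by (intro measurable_slice borel_measurable_inner_nn_integral borel_measurable_inner_integral;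
        use g j Suc.prems in simp)+
  have [measurable]: "\<phi> \<in> borel_measurable (\<mu> j)" unfolding \<phi>_def by measurable
  have fin: "integral\<^sup>N (\<mu> j) \<phi> < \<infinity>" using Suc.prems by (simp add: \<phi>_def)
  then have "AE t in \<mu> j. \<phi> t \<noteq> \<infinity>" by (intro nn_integral_noteq_infinite) auto
  then have "AE t in \<mu> j. indicator (J j) t *\<^sub>R inner_integral T a b l (Suc j) g (x(j := t)) = enn2real (\<phi> t)"
  proof eventually_elim
    case (elim t)
    have "x(j := t) \<in> extensional {..<n}" using Suc.prems j by (auto simp: extensional_def)
    note IH = Suc.IH[OF this]
    show ?case
      using elim IH Suc.prems by (cases "t \<in> J j") (simp_all add: \<phi>_def less_top del: fun_upd_apply)
  qed
  then have "inner_integral T a b (Suc l) j g x = (\<integral>t. enn2real (\<phi> t) \<partial>\<mu> j)"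
    by (simp add: set_lebesgue_integral_def) (intro integral_cong_AE; measurable)
  also have "\<dots> = enn2real (integral\<^sup>N (\<mu> j) \<phi>)" using fin by (intro integrable_enn2real) auto
  finally show ?case by (simp add: \<phi>_def)
qed (use g in simp)

text \<open>Where an integral of \<open>h\<close> does not exist, its value is \<open>0\<close>, which is at most the non-negative
  right-hand side.\<close>

lemma inner_integral_le:
  assumes w: "\<And>i. w i \<in> borel_measurable product_borel" "\<And>i y. 0 \<le> w i y"
    and c: "\<And>i. 0 \<le> c i"
    and h: "\<And>y. y \<in> Q n \<Longrightarrow> (\<And>i. i < j \<Longrightarrow> y i = x i) \<Longrightarrow> h y \<le> (\<Sum>i\<in>I. c i * w i y)"
    and x: "x \<in> Q j" and jl: "j + l = n"
    and fin: "\<And>i. i \<in> I \<Longrightarrow> inner_nn_integral T a b l j (\<lambda>y. ennreal (w i y)) x < \<infinity>"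
    and I: "finite I"
  shows "inner_integral T a b l j h x
    \<le> (\<Sum>i\<in>I. c i * enn2real (inner_nn_integral T a b l j (\<lambda>y. ennreal (w i y)) x))"
  using h x jl fin
proof (induction l arbitrary: j x)
  case 0
  then show ?case using w by simp
next
  case (Suc l)
  then have j: "j < n" by simp
  define \<phi> where "\<phi> i = (\<lambda>t. inner_nn_integral T a b l (Suc j) (\<lambda>y. ennreal (w i y)) (x(j := t))
    * indicator (J j) t)" for i
  have [measurable]: "J j \<in> sets (\<mu> j)" using sets_J[OF j] by (simp add: sets_delta)
  have [measurable]: "(\<lambda>t. inner_nn_integral T a b l (Suc j) (\<lambda>y. ennreal (w i y)) (x(j := t)))
      \<in> borel_measurable (\<mu> j)" for i
    using w j Suc.prems by (intro measurable_slice borel_measurable_inner_nn_integral)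
      (auto simp: initial_box_def)
  have [measurable]: "\<phi> i \<in> borel_measurable (\<mu> j)" for i unfolding \<phi>_def by measurable
  have fin: "integral\<^sup>N (\<mu> j) (\<phi> i) < \<infinity>" if "i \<in> I" for i
    using Suc.prems(4)[OF that] by (simp add: \<phi>_def)
  have ae: "AE t in \<mu> j. \<phi> i t \<noteq> \<infinity>" if "i \<in> I" for i using fin[OF that] by (intro nn_integral_noteq_infinite) auto
  have int: "integrable (\<mu> j) (\<lambda>t. enn2real (\<phi> i t))"
    and val: "(\<integral>t. enn2real (\<phi> i t) \<partial>\<mu> j) = enn2real (integral\<^sup>N (\<mu> j) (\<phi> i))" if "i \<in> I" for i
    using fin[OF that] by (intro integrable_enn2real; simp)+
  have "AE t in \<mu> j. \<forall>i\<in>I. \<phi> i t \<noteq> \<infinity>" using ae I by (simp add: AE_finite_all)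
  then have le: "AE t in \<mu> j. indicator (J j) t *\<^sub>R inner_integral T a b l (Suc j) h (x(j := t))
      \<le> (\<Sum>i\<in>I. c i * enn2real (\<phi> i t))"
  proof eventually_elim
    case (elim t)
    show ?case
    proof (cases "t \<in> J j")
      case True
      have "inner_integral T a b l (Suc j) h (x(j := t)) \<le> (\<Sum>i\<in>I. c i
          * enn2real (inner_nn_integral T a b l (Suc j) (\<lambda>y. ennreal (w i y)) (x(j := t))))"
      proof (rule Suc.IH)
        show "x(j := t) \<in> Q (Suc j)" using Suc.prems(2) j True by (rule initial_box_upd)
        show "h y \<le> (\<Sum>i\<in>I. c i * w i y)" if y: "y \<in> Q n" "\<And>i. i < Suc j \<Longrightarrow> y i = (x(j := t)) i" for y
          using y(1)
        proof (rule Suc.prems(1))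
          show "y i = x i" if "i < j" for i using y(2)[of i] that by simp
        qed
        show "inner_nn_integral T a b l (Suc j) (\<lambda>y. ennreal (w i y)) (x(j := t)) < \<infinity>" if "i \<in> I" for i
          using elim that True by (auto simp: \<phi>_def less_top)
      qed (use Suc.prems in simp)
      then show ?thesis using True by (simp add: \<phi>_def)
    qed (simp add: \<phi>_def)
  qed
  have "inner_integral T a b (Suc l) j h x
      = (\<integral>t. indicator (J j) t *\<^sub>R inner_integral T a b l (Suc j) h (x(j := t)) \<partial>\<mu> j)"
    by (simp add: set_lebesgue_integral_def)
  also have "\<dots> \<le> (\<integral>t. (\<Sum>i\<in>I. c i * enn2real (\<phi> i t)) \<partial>\<mu> j)"
  proof (rule integral_mono_AE'[OF _ le])
    show "integrable (\<mu> j) (\<lambda>t. \<Sum>i\<in>I. c i * enn2real (\<phi> i t))"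
      by (intro Bochner_Integration.integrable_sum integrable_mult_right int)
    show "AE t in \<mu> j. 0 \<le> (\<Sum>i\<in>I. c i * enn2real (\<phi> i t))"
      using c by (intro AE_I2 sum_nonneg) simp
  qed
  also have "\<dots> = (\<Sum>i\<in>I. c i * enn2real (integral\<^sup>N (\<mu> j) (\<phi> i)))"
    by (simp add: int val)
  finally show ?case by (simp add: \<phi>_def)
qed

end

section \<open>Functions with monotone partial derivatives\<close>

text \<open>\<open>class_H\<close> prescribes signs and monotonicity on the open
  \<open>pos_cube\<close>, whereas \<open>\<bar>f k x\<bar>\<close> and the partial masses can be 0.
  This is the set on which the two properties are needed.\<close>

definition nonneg_cube :: "ereal \<Rightarrow> (real ^ 'm) set" where
  "nonneg_cube R = {t. \<forall>i. 0 \<le> t $ i \<and> ereal (t $ i) < R}"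

lemma vec_upd_nth: "vec_upd t i s $ k = (if k = i then s else t $ k)"
  by (simp add: vec_upd_def)

lemma nonneg_cube_subset: "0 < R \<Longrightarrow> nonneg_cube R \<subseteq> open_cube R"
  unfolding nonneg_cube_def open_cube_def
  by (auto intro: less_le_trans[of "- R" 0] simp: ereal_uminus_less_reorder)

context
  fixes R :: ereal and F :: "real ^ 'm \<Rightarrow> real"
  assumes R: "0 < R" and F: "F \<in> class_H R"
begin

lemma tendsto_partial_deriv:
  assumes "(X \<longlongrightarrow> x) G" "x \<in> nonneg_cube R" "\<forall>\<^sub>F k in G. X k \<in> nonneg_cube R"
  shows "((\<lambda>k. partial_deriv i F (X k)) \<longlongrightarrow> partial_deriv i F x) G"
proof (rule continuous_on_tendsto_compose[OF _ assms(1)])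
  show "continuous_on (open_cube R) (partial_deriv i F)"
    using F by (simp add: class_H_def C1_on_cube_def)
  show "x \<in> open_cube R" using assms nonneg_cube_subset[OF R] by auto
  show "\<forall>\<^sub>F k in G. X k \<in> open_cube R"
    using assms(3) by eventually_elim (use nonneg_cube_subset[OF R] in auto)
qed

text \<open>Moving all coordinates up by 1/(k+1) enters \<open>pos_cube\<close>; continuity of the
  partial derivatives then carries sign and monotonicity over to the faces with zero
  coordinates.\<close>

lemma pos_cube_shift:
  assumes "u \<in> nonneg_cube R"
  shows "\<forall>\<^sub>F k in sequentially. (\<chi> i. u $ i + 1 / real (Suc k)) \<in> pos_cube R"
    and "(\<lambda>k. partial_deriv j F (\<chi> i. u $ i + 1 / real (Suc k))) \<longlonglongrightarrow> partial_deriv j F u"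
proof -
  have lim: "(\<lambda>k. u $ i + 1 / real (Suc k)) \<longlonglongrightarrow> u $ i" for i
  proof -
    have "(\<lambda>k. u $ i + 1 / real (Suc k)) \<longlonglongrightarrow> u $ i + 0"
      by (intro tendsto_intros LIMSEQ_Suc[OF lim_const_over_n])
    then show ?thesis by simp
  qed
  have "\<forall>\<^sub>F k in sequentially. ereal (u $ i + 1 / real (Suc k)) < R" for i
    using assms by (intro order_tendstoD[OF tendsto_ereal[OF lim]]) (auto simp: nonneg_cube_def)
  then have "\<forall>\<^sub>F k in sequentially. \<forall>i. ereal (u $ i + 1 / real (Suc k)) < R"
    by (simp add: eventually_all_finite)
  then show *: "\<forall>\<^sub>F k in sequentially. (\<chi> i. u $ i + 1 / real (Suc k)) \<in> pos_cube R"
    by eventually_elim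
      (use assms in \<open>auto simp: pos_cube_def nonneg_cube_def intro!: add_nonneg_pos\<close>)
  have "(\<lambda>k. \<chi> i. u $ i + 1 / real (Suc k)) \<longlonglongrightarrow> (\<chi> i. u $ i)"
    by (intro tendsto_vec_lambda lim)
  then show "(\<lambda>k. partial_deriv j F (\<chi> i. u $ i + 1 / real (Suc k))) \<longlonglongrightarrow> partial_deriv j F u"
    by (intro tendsto_partial_deriv assms eventually_mono[OF *])
      (auto simp: pos_cube_def nonneg_cube_def less_imp_le)
qed

lemma partial_deriv_nonneg:
  assumes "u \<in> nonneg_cube R"
  shows "0 \<le> partial_deriv j F u"
proof (rule tendsto_lowerbound[OF pos_cube_shift(2)[OF assms]])
  show "\<forall>\<^sub>F k in sequentially. 0 \<le> partial_deriv j F (\<chi> i. u $ i + 1 / real (Suc k))"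
    using pos_cube_shift(1)[OF assms]
    by eventually_elim (use F in \<open>simp add: class_H_def\<close>)
qed simp

text \<open>The hypothesis moves one coordinate at a time, so the coordinates in a growing set
  \<open>A\<close> are switched from \<open>u\<close> to \<open>v\<close>.\<close>

lemma partial_deriv_mono_pos:
  assumes u: "u \<in> pos_cube R" and v: "v \<in> pos_cube R" and le: "\<And>i. u $ i \<le> v $ i"
  shows "partial_deriv j F u \<le> partial_deriv j F v"
proof -
  define w where "w A = (\<chi> k. if k \<in> A then v $ k else u $ k)" for A
  have "partial_deriv j F u \<le> partial_deriv j F (w A)" if "finite A" for A
    using that
  proof induction
    case empty
    then show ?case by (simp add: w_def)
  next
    case (insert i A)
    have "w A \<in> pos_cube R" using u v by (auto simp: pos_cube_def w_def)
    moreover have "w A $ i \<le> v $ i" "ereal (v $ i) < R"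
      using le v by (auto simp: pos_cube_def w_def)
    ultimately have "partial_deriv j F (w A) \<le> partial_deriv j F (vec_upd (w A) i (v $ i))"
      using F by (simp add: class_H_def)
    also have "vec_upd (w A) i (v $ i) = w (insert i A)"
      by (auto simp: w_def vec_upd_def vec_eq_iff)
    finally show ?case using insert by simp
  qed
  from this[of UNIV] show ?thesis by (simp add: w_def)
qed

lemma partial_deriv_mono:
  assumes u: "u \<in> nonneg_cube R" and v: "v \<in> nonneg_cube R" and le: "\<And>i. u $ i \<le> v $ i"
  shows "partial_deriv j F u \<le> partial_deriv j F v"
proof (rule tendsto_le[OF _ pos_cube_shift(2)[OF v] pos_cube_shift(2)[OF u]])
  show "\<forall>\<^sub>F k in sequentially. partial_deriv j F (\<chi> i. u $ i + 1 / real (Suc k))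
      \<le> partial_deriv j F (\<chi> i. v $ i + 1 / real (Suc k))"
    using pos_cube_shift(1)[OF u] pos_cube_shift(1)[OF v]
    by eventually_elim (use le in \<open>auto intro: partial_deriv_mono_pos\<close>)
qed simp

text \<open>Telescope along a coordinate path from \<open>u\<close> to \<open>v\<close>. On the edge
  in direction \<open>i\<close> the mean value theorem yields \<open>D\<^sub>i F\<close> at a point
  that dominates \<open>u\<close> componentwise, so replacing it by the value at \<open>u\<close>
  only decreases the product.\<close>

lemma class_H_increment:
  assumes u: "u \<in> nonneg_cube R" and v: "v \<in> nonneg_cube R" and le: "\<And>i. u $ i \<le> v $ i"
  shows "(\<Sum>i\<in>UNIV. partial_deriv i F u * (v $ i - u $ i)) \<le> F v - F u"
proof -
  define w where "w A = (\<chi> k. if k \<in> A then v $ k else u $ k)" for A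
  have "(\<Sum>i\<in>A. partial_deriv i F u * (v $ i - u $ i)) \<le> F (w A) - F u" if "finite A" for A
    using that
  proof induction
    case empty
    then show ?case by (simp add: w_def)
  next
    case (insert i A)
    have cube: "vec_upd (w A) i s \<in> nonneg_cube R" if "u $ i \<le> s" "s \<le> v $ i" for s
    proof -
      have "ereal s \<le> ereal (v $ i)" using that by simp
      also have "\<dots> < R" using v by (simp add: nonneg_cube_def)
      finally show ?thesis
        using u v that order_trans[of 0 "u $ i" s]
        by (auto simp: nonneg_cube_def w_def vec_upd_nth)
    qed
    have wi: "w (insert i A) = vec_upd (w A) i (v $ i)" "w A = vec_upd (w A) i (u $ i)"
      using insert by (auto simp: w_def vec_upd_def vec_eq_iff)
    have "partial_deriv i F u * (v $ i - u $ i) \<le> F (w (insert i A)) - F (w A)"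
    proof (cases "u $ i = v $ i")
      case True
      then show ?thesis using wi by simp
    next
      case False
      with le have lt: "u $ i < v $ i" by (simp add: order_less_le)
      have "((\<lambda>s. F (vec_upd (w A) i s)) has_real_derivative partial_deriv i F (vec_upd (w A) i s)) (at s)"
        if "u $ i \<le> s" "s \<le> v $ i" for s
      proof -
        have "vec_upd (w A) i s \<in> open_cube R"
          using cube[OF that] nonneg_cube_subset[OF R] by auto
        then have "(\<lambda>r. F (vec_upd (vec_upd (w A) i s) i r)) differentiable at (vec_upd (w A) i s $ i)"
          using F by (auto simp: class_H_def C1_on_cube_def)
        moreover have "vec_upd (vec_upd (w A) i s) i = vec_upd (w A) i"
          by (auto simp: vec_upd_def vec_eq_iff)
        ultimately have "(\<lambda>r. F (vec_upd (w A) i r)) differentiable at s"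
          by (simp add: vec_upd_nth)
        then show ?thesis
          using \<open>vec_upd (vec_upd (w A) i s) i = vec_upd (w A) i\<close>
          by (simp add: partial_deriv_def vec_upd_nth DERIV_deriv_iff_real_differentiable)
      qed
      from MVT2[OF lt this] obtain z where z: "u $ i < z" "z < v $ i"
        "F (vec_upd (w A) i (v $ i)) - F (vec_upd (w A) i (u $ i))
          = (v $ i - u $ i) * partial_deriv i F (vec_upd (w A) i z)"
        by blast
      have "partial_deriv i F u \<le> partial_deriv i F (vec_upd (w A) i z)"
        using u cube[of z] z le by (intro partial_deriv_mono) (auto simp: vec_upd_nth w_def)
      then have "partial_deriv i F u * (v $ i - u $ i)
          \<le> partial_deriv i F (vec_upd (w A) i z) * (v $ i - u $ i)"
        using lt by (intro mult_right_mono) auto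
      also have "\<dots> = F (w (insert i A)) - F (w A)"
        using z(3) wi by (simp add: mult.commute)
      finally show ?thesis .
    qed
    with insert show ?case by simp
  qed
  from this[of UNIV] show ?thesis by (simp add: w_def)
qed

text \<open>Replacing \<open>H\<close> on each interval of a partition by its value at the left endpoint turns the
  integral into a sum that is dominated by the telescoping sum of the increments of \<open>F \<circ> H\<close>;
  the partitions are refined by dominated convergence, since \<open>H\<close> is left-continuous.\<close>

lemma
  fixes M :: "real measure" and N :: "'m \<Rightarrow> real \<Rightarrow> real" and a b :: real
  assumes M: "sets M = sets borel"
    and int: "\<And>i. integrable M (N i)"
    and N0: "\<And>i s. 0 \<le> N i s"
    and supp: "\<And>i s. s \<notin> {a..<b} \<Longrightarrow> N i s = 0"
    and less: "\<And>i. ereal (\<integral>s. N i s \<partial>M) < R"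
  defines "H \<equiv> \<lambda>t. \<chi> i. \<integral>s. indicator {..<t} s * N i s \<partial>M"
  shows class_H_chain_in_cube: "H t \<in> nonneg_cube R" (is ?cube)
    and integrable_class_H_chain:
      "integrable M (\<lambda>t. \<Sum>i\<in>UNIV. partial_deriv i F (H t) * N i t)" (is ?integrable)
    and integral_class_H_chain_le:
      "(\<integral>t. (\<Sum>i\<in>UNIV. partial_deriv i F (H t) * N i t) \<partial>M) \<le> F (\<chi> i. \<integral>s. N i s \<partial>M)" (is ?le)
proof -
  have [measurable_cong]: "sets M = sets borel" by (fact M)
  note [measurable] = borel_measurable_integrable[OF int]
  have ind: "integrable M (\<lambda>s. indicator A s * N i s)" if [measurable]: "A \<in> sets borel" for A i
    using int[of i] by (rule Bochner_Integration.integrable_bound) (auto simp: indicator_def)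
  define tot where "tot = (\<chi> i. \<integral>s. N i s \<partial>M)"
  have Hle: "H t $ i \<le> tot $ i" for t i
    unfolding H_def tot_def vec_lambda_beta
    by (intro integral_mono ind int) (auto simp: indicator_def N0)
  have H0: "0 \<le> H t $ i" for t i
    unfolding H_def using N0 by (auto intro!: integral_nonneg_AE simp: indicator_def)
  have tot0: "0 \<le> tot $ i" for i
    unfolding tot_def using N0 by (auto intro!: integral_nonneg_AE)
  have totC: "tot \<in> nonneg_cube R" using less tot0 by (auto simp: nonneg_cube_def tot_def)
  have HC: "H t \<in> nonneg_cube R" for t
  proof -
    have "ereal (H t $ i) < R" for i
      using Hle[of t i] less[of i]
      by (simp add: tot_def) (meson ereal_less_eq(3) le_less_trans)
    then show ?thesis using H0 by (auto simp: nonneg_cube_def)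
  qed
  have Hdiff: "H t $ i - H s $ i = (\<integral>r. indicator {s..<t} r * N i r \<partial>M)" if "s \<le> t" for s t i
  proof -
    have "H t $ i - H s $ i = (\<integral>r. indicator {..<t} r * N i r - indicator {..<s} r * N i r \<partial>M)"
      unfolding H_def by (subst Bochner_Integration.integral_diff) (auto intro: ind)
    also have "\<dots> = (\<integral>r. indicator {s..<t} r * N i r \<partial>M)"
      using that by (intro Bochner_Integration.integral_cong) (auto simp: indicator_def)
    finally show ?thesis .
  qed
  have Hmono: "H s $ i \<le> H t $ i" if "s \<le> t" for s t i
  proof -
    have "0 \<le> (\<integral>r. indicator {s..<t} r * N i r \<partial>M)"
      using N0 by (auto intro!: integral_nonneg_AE simp: indicator_def)
    with Hdiff[OF that, of i] show ?thesis by simp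
  qed
  show ?cube by (rule HC)
  \<comment> \<open>\<open>P k t\<close> is the left endpoint of the cell containing
    \<open>t\<close> in the grid of mesh 1/(k+1) anchored at \<open>a\<close>. For
    \<open>t < a\<close> the conversion \<open>nat\<close> gives \<open>a\<close>, which is harmless
    since \<open>N i t = 0\<close> there.\<close>
  define P where "P k t = a + real (nat \<lfloor>(t - a) * real (Suc k)\<rfloor>) / real (Suc k)" for k t
  have P_le: "P k t \<le> t" and P_gt: "t - 1 / real (Suc k) < P k t" if "a \<le> t" for k t
  proof -
    have "0 \<le> (t - a) * real (Suc k)" using that by simp
    then have le: "real (nat \<lfloor>(t - a) * real (Suc k)\<rfloor>) \<le> (t - a) * real (Suc k)"
      and gt: "(t - a) * real (Suc k) - 1 < real (nat \<lfloor>(t - a) * real (Suc k)\<rfloor>)" by linarith+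
    show "P k t \<le> t"
      using divide_right_mono[OF le, of "real (Suc k)"] by (simp add: P_def del: of_nat_Suc)
    show "t - 1 / real (Suc k) < P k t"
      using divide_strict_right_mono[OF gt, of "real (Suc k)"]
      by (simp add: P_def diff_divide_distrib del: of_nat_Suc)
  qed
  have P_lim: "(\<lambda>k. P k t) \<longlonglongrightarrow> t" if "a \<le> t" for t
  proof -
    have "(\<lambda>k. t - 1 / real (Suc k)) \<longlonglongrightarrow> t - 0"
      by (intro tendsto_intros LIMSEQ_Suc[OF lim_const_over_n])
    then have lo: "(\<lambda>k. t - 1 / real (Suc k)) \<longlonglongrightarrow> t" by simp
    show ?thesis
      by (rule tendsto_sandwich[OF _ _ lo tendsto_const])
        (use P_le[OF that] P_gt[OF that] in \<open>simp_all add: less_imp_le del: of_nat_Suc\<close>)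
  qed
  have H_lim: "(\<lambda>k. H (P k t)) \<longlonglongrightarrow> H t" if t: "a \<le> t" for t
    unfolding H_def
  proof (intro tendsto_vec_lambda integral_dominated_convergence[where w = "N i" for i])
    fix i
    show "AE s in M. (\<lambda>k. indicator {..<P k t} s * N i s) \<longlonglongrightarrow> indicator {..<t} s * N i s"
    proof (intro AE_I2 tendsto_mult tendsto_const)
      fix s
      \<comment> \<open>Because \<open>P k t \<le> t\<close>, both indicators vanish at
        \<open>s = t\<close>: an atom at \<open>t\<close> causes no jump in the limit.\<close>
      show "(\<lambda>k. indicator {..<P k t} s :: real) \<longlonglongrightarrow> indicator {..<t} s"
      proof (cases "s < t")
        case True
        have "\<forall>\<^sub>F k in sequentially. s < P k t" using P_lim[OF t] True by (rule order_tendstoD)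
        then have "\<forall>\<^sub>F k in sequentially. indicator {..<P k t} s = (indicator {..<t} s :: real)"
          by eventually_elim (use True in simp)
        then show ?thesis by (rule tendsto_eventually)
      next
        case False
        then have "\<not> s < P k t" for k using P_le[OF t, of k] by linarith
        with False show ?thesis by simp
      qed
    qed
    show "AE s in M. norm (indicator {..<P k t} s * N i s) \<le> N i s" for k
      using N0 by (auto simp: indicator_def)
  qed (use int in auto)
  define G where "G k t = (\<Sum>i\<in>UNIV. partial_deriv i F (H (P k t)) * N i t)" for k t
  \<comment> \<open>The majorant freezes the monotone partial derivatives at \<open>tot\<close>, the
    largest argument that \<open>H\<close> can reach.\<close>
  define W where "W t = (\<Sum>i\<in>UNIV. partial_deriv i F tot * N i t)" for t
  have G_meas [measurable]: "G k \<in> borel_measurable M" for k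
  proof -
    \<comment> \<open>\<open>P k\<close> takes countably many values, one for each natural number,
      so measurability follows by a countable case split.\<close>
    have "(\<lambda>t. partial_deriv i F (H (P k t))) \<in> borel_measurable M" for i
      unfolding P_def
      by (rule measurable_compose_countable
          [of "\<lambda>n t. partial_deriv i F (H (a + real n / real (Suc k)))"]) measurable
    then show ?thesis unfolding G_def by measurable
  qed
  have W_int: "integrable M W"
    unfolding W_def by (intro Bochner_Integration.integrable_sum integrable_mult_right int)
  have G_bound: "norm (G k t) \<le> W t" for k t
  proof -
    have "0 \<le> G k t" unfolding G_def using N0 partial_deriv_nonneg[OF HC]
      by (intro sum_nonneg mult_nonneg_nonneg) auto
    moreover have "G k t \<le> W t" unfolding G_def W_def
      using N0 partial_deriv_mono[OF HC totC Hle] by (intro sum_mono mult_right_mono) auto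
    ultimately show ?thesis by simp
  qed
  have G_int: "integrable M (G k)" for k
    using W_int
  proof (rule Bochner_Integration.integrable_bound)
    show "AE t in M. norm (G k t) \<le> norm (W t)"
    proof (rule AE_I2)
      show "norm (G k t) \<le> norm (W t)" for t using G_bound[of k t] by simp
    qed
  qed measurable
  have G_lim: "(\<lambda>k. G k t) \<longlonglongrightarrow> (\<Sum>i\<in>UNIV. partial_deriv i F (H t) * N i t)" for t
  proof (cases "a \<le> t")
    case True
    show ?thesis unfolding G_def
      by (intro tendsto_intros tendsto_partial_deriv H_lim True HC always_eventually allI)
  qed (simp add: G_def supp)
  have lim_meas: "(\<lambda>t. \<Sum>i\<in>UNIV. partial_deriv i F (H t) * N i t) \<in> borel_measurable M"
    by (rule borel_measurable_LIMSEQ_real[OF G_lim G_meas])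
  show ?integrable
    by (rule integrable_dominated_convergence[where s = G, OF lim_meas G_meas W_int])
      (simp_all only: G_lim G_bound AE_I2)
  have conv: "(\<lambda>k. \<integral>t. G k t \<partial>M) \<longlonglongrightarrow> (\<integral>t. (\<Sum>i\<in>UNIV. partial_deriv i F (H t) * N i t) \<partial>M)"
    by (rule integral_dominated_convergence[where s = G, OF lim_meas G_meas W_int])
      (simp_all only: G_lim G_bound AE_I2)
  have "(\<integral>t. G k t \<partial>M) \<le> F tot" for k
  proof -
    define q where "q p = a + real p / real (Suc k)" for p
    have ind_G: "integrable M (\<lambda>s. indicator A s * G k s)" if [measurable]: "A \<in> sets borel" for A
      using G_int[of k] by (rule Bochner_Integration.integrable_bound) (auto simp: indicator_def)
    have "(\<integral>t. indicator {..<q p} t * G k t \<partial>M) \<le> F (H (q p))" for p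
    proof (induction p)
      case 0
      have "H (q 0) = 0"
      proof -
        have "(\<lambda>s. indicator {..<a} s * N i s) = (\<lambda>_. 0)" for i
          using supp by (auto simp: fun_eq_iff indicator_def)
        then show ?thesis by (simp add: H_def q_def vec_eq_iff)
      qed
      moreover have "(\<lambda>t. indicator {..<q 0} t * G k t) = (\<lambda>_. 0)"
        using supp by (auto simp: fun_eq_iff indicator_def q_def G_def)
      moreover have "F 0 = 0" using F by (simp add: class_H_def)
      ultimately show ?case by simp
    next
      case (Suc p)
      have qle: "q p \<le> q (Suc p)" by (simp add: q_def field_simps)
      have Pq: "P k t = q p" if "q p \<le> t" "t < q (Suc p)" for t
      proof -
        have "real p \<le> (t - a) * real (Suc k)" "(t - a) * real (Suc k) < real p + 1"
          using that by (simp_all add: q_def field_simps del: of_nat_Suc)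
        then have "nat \<lfloor>(t - a) * real (Suc k)\<rfloor> = p" by linarith
        then show ?thesis by (simp add: P_def q_def)
      qed
      \<comment> \<open>On the cell from \<open>q p\<close> up to \<open>q (Suc p)\<close> the
        coefficients of \<open>G k\<close> are frozen at \<open>H (q p)\<close>, so its contribution
        is exactly the sum bounded in \<open>class_H_increment\<close>.\<close>
      have "(\<integral>t. indicator {..<q (Suc p)} t * G k t \<partial>M)
          = (\<integral>t. indicator {..<q p} t * G k t
              + (\<Sum>i\<in>UNIV. partial_deriv i F (H (q p)) * (indicator {q p..<q (Suc p)} t * N i t)) \<partial>M)"
        using qle by (intro Bochner_Integration.integral_cong) (auto simp: indicator_def G_def Pq)
      also have "\<dots> = (\<integral>t. indicator {..<q p} t * G k t \<partial>M)
          + (\<Sum>i\<in>UNIV. partial_deriv i F (H (q p)) * (H (q (Suc p)) $ i - H (q p) $ i))"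
        by (simp add: ind ind_G Hdiff[OF qle])
      also have "\<dots> \<le> F (H (q p)) + (F (H (q (Suc p))) - F (H (q p)))"
        using Suc.IH class_H_increment[OF HC HC Hmono[OF qle]] by (rule add_mono)
      finally show ?case by simp
    qed
    moreover obtain p where p: "b \<le> q p"
    proof -
      obtain p where "(b - a) * real (Suc k) < real p" using reals_Archimedean2 by blast
      then have "b \<le> q p" by (simp add: q_def field_simps del: of_nat_Suc)
      then show ?thesis using that by blast
    qed
    moreover have "(\<lambda>t. indicator {..<q p} t * G k t) = G k"
      using supp p by (auto simp: fun_eq_iff indicator_def G_def)
    moreover have "H (q p) = tot"
    proof -
      have "(\<lambda>t. indicator {..<q p} t * N i t) = N i" for i
        using supp p by (auto simp: fun_eq_iff indicator_def)
      then show ?thesis by (simp add: H_def tot_def)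
    qed
    ultimately show ?thesis by metis
  qed
  then show ?le
    unfolding tot_def[symmetric] by (intro LIMSEQ_le_const2[OF conv]) auto
qed

end

section \<open>Bounding a function by its mixed derivative\<close>

lemma PiE_partials_dom_iff:
  "x \<in> PiE {..<n} (partials_dom S i) \<longleftrightarrow> x \<in> extensional {..<n} \<and>
    (\<forall>k<n. (k < i \<longrightarrow> x k \<in> ts_kappa (S k)) \<and> (\<not> k < i \<longrightarrow> x k \<in> S k))"
proof -
  have "x k \<in> partials_dom S i k \<longleftrightarrow> (k < i \<longrightarrow> x k \<in> ts_kappa (S k)) \<and> (\<not> k < i \<longrightarrow> x k \<in> S k)" for k
    by (simp add: partials_dom_def)
  then show ?thesis by (auto simp: PiE_iff)
qed

lemma in_partials_dom_upd:
  assumes "x \<in> PiE {..<n} (partials_dom S i)" "i < n"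
  shows "t \<in> S i \<Longrightarrow> x(i := t) \<in> PiE {..<n} (partials_dom S i)"
    and "t \<in> ts_kappa (S i) \<Longrightarrow> x(i := t) \<in> PiE {..<n} (partials_dom S (Suc i))"
  using assms by (auto simp: PiE_partials_dom_iff extensional_def less_Suc_eq)

context ts_intervals
begin

text \<open>Uniqueness on \<open>ts_kappa\<close> turns the description \<open>THE\<close> in
  \<open>delta_deriv\<close> into an actual derivative.\<close>

lemma delta_partials_has_deriv:
  assumes f: "f \<in> class_L T a b n" and i: "i < n"
    and x: "x \<in> PiE {..<n} (partials_dom S i)" and t: "t \<in> ts_kappa (S i)"
  shows "has_delta_deriv (S i) (\<lambda>t. delta_partials S i f (x(i := t)))
    (delta_partials S (Suc i) f (x(i := t))) t"
proof -
  have y: "x(i := t) \<in> PiE {..<n} (partials_dom S (Suc i))"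
    using x i t by (rule in_partials_dom_upd)
  have "has_delta_partials S n n f" using f by (simp add: class_L_def)
  then obtain D where "has_delta_deriv (S i) (\<lambda>u. delta_partials S i f ((x(i := t))(i := u))) D ((x(i := t)) i)"
    using i y unfolding has_delta_partials_def by blast
  then have D: "has_delta_deriv (S i) (\<lambda>u. delta_partials S i f (x(i := u))) D t" by simp
  then have "delta_deriv (S i) (\<lambda>u. delta_partials S i f (x(i := u))) t = D"
    using ts_interval.delta_deriv_eq[OF interval[OF i]] t by (simp add: ts_box_def)
  with D show ?thesis by simp
qed

text \<open>Differentiating in an earlier variable \<open>i < j\<close> moves within the face
  \<open>x j = a j\<close>, where the slice is identically zero. The forward jump stays in the box
  because it is taken in \<open>S i\<close>.\<close>

lemma delta_partials_vanish:
  assumes f: "f \<in> class_L T a b n" and "i \<le> n" "x \<in> PiE {..<n} (partials_dom S i)"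
    and "i \<le> j" "j < n" "x j = a j"
  shows "delta_partials S i f x = 0"
  using assms(2-)
proof (induction i arbitrary: x)
  case 0
  then show ?case using f by (auto simp: class_L_def partials_dom_def)
next
  case (Suc i)
  then have i: "i < n" and ij: "i \<noteq> j" by auto
  interpret I: ts_interval "T i" "a i" "b i" using i by (rule interval)
  have S: "S i = T i \<inter> {a i..b i}" by (simp add: ts_box_def)
  let ?g = "\<lambda>t. delta_partials S i f (x(i := t))"
  have xi: "x i \<in> ts_kappa (S i)" using Suc.prems i by (auto simp: PiE_partials_dom_iff)
  then have xS: "x i \<in> S i" by (simp add: ts_kappa_def)
  have x: "x \<in> PiE {..<n} (partials_dom S i)"
    using Suc.prems xS by (auto simp: PiE_partials_dom_iff less_Suc_eq ts_kappa_def)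
  have g: "?g t = 0" if "t \<in> S i" for t
  proof (rule Suc.IH)
    show "x(i := t) \<in> PiE {..<n} (partials_dom S i)" using x i that by (rule in_partials_dom_upd)
  qed (use Suc.prems ij in simp_all)
  have \<sigma>: "fjump (S i) (x i) \<in> S i" using I.fjump_S_in xS unfolding S by auto
  have "has_delta_deriv (S i) ?g 0 (x i)"
    unfolding has_delta_deriv_def delta_filter_def
    by (rule tendsto_eventually) (auto simp: eventually_inf_principal g \<sigma> intro!: always_eventually)
  then have "delta_deriv (S i) ?g (x i) = 0"
    using xi I.delta_deriv_eq unfolding S by auto
  then show ?case by simp
qed

lemma abs_delta_partials_le:
  assumes f: "f \<in> class_L T a b n" and i: "i < n" and x: "x \<in> PiE {..<n} (partials_dom S i)"
  shows "ennreal \<bar>delta_partials S i f x\<bar>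
    \<le> (\<integral>\<^sup>+t\<in>T i \<inter> {a i..<x i}. ennreal \<bar>delta_partials S (Suc i) f (x(i := t))\<bar> \<partial>\<mu> i)"
proof -
  interpret I: ts_interval "T i" "a i" "b i" using i by (rule interval)
  have S: "S i = T i \<inter> {a i..b i}" by (simp add: ts_box_def)
  have xi: "x i \<in> S i" using x i by (auto simp: PiE_partials_dom_iff)
  have aS: "a i \<in> S i" "a i \<in> ts_kappa (S i)"
    using I.a_in_kappa I.aT I.ab by (auto simp: S)
  \<comment> \<open>The coordinate \<open>x i\<close> may be a left-scattered \<open>b i\<close>,
    outside the domain of the next derivative. The slice does not depend on it, so
    \<open>a i\<close> is used instead.\<close>
  have "x(i := a i) \<in> PiE {..<n} (partials_dom S (Suc i))"
    using in_partials_dom_upd(2)[OF x i aS(2)] .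
  moreover have "rd_continuous_prod (partials_dom S (Suc i)) n (delta_partials S (Suc i) f)"
    using f i by (auto simp: class_L_def simp del: delta_partials.simps)
  ultimately have "rd_continuous_on (partials_dom S (Suc i) i)
      (\<lambda>t. delta_partials S (Suc i) f ((x(i := a i))(i := t)))"
    using i unfolding rd_continuous_prod_def by blast
  then have rd: "rd_continuous_on (ts_kappa (S i)) (\<lambda>t. delta_partials S (Suc i) f (x(i := t)))"
    by (simp add: partials_dom_def del: delta_partials.simps)
  have "ennreal \<bar>delta_partials S i f (x(i := x i))\<bar>
      \<le> (\<integral>\<^sup>+t\<in>T i \<inter> {a i..<x i}. ennreal \<bar>delta_partials S (Suc i) f (x(i := t))\<bar> \<partial>\<mu> i)"
  proof (rule I.abs_le_nn_integral_delta_deriv)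
    show "has_delta_deriv (T i \<inter> {a i..b i}) (\<lambda>t. delta_partials S i f (x(i := t)))
        (delta_partials S (Suc i) f (x(i := t))) t" if "t \<in> ts_kappa (T i \<inter> {a i..b i})" for t
      using delta_partials_has_deriv[OF f i x] that unfolding S by blast
    show "rd_continuous_on (ts_kappa (T i \<inter> {a i..b i})) (\<lambda>t. delta_partials S (Suc i) f (x(i := t)))"
      using rd unfolding S .
    show "delta_partials S i f (x(i := a i)) = 0"
      using i in_partials_dom_upd(1)[OF x i aS(1)] by (intro delta_partials_vanish[OF f, where j = i]) auto
    show "x i \<in> T i \<inter> {a i..b i}" using xi by (simp add: S)
  qed
  then show ?thesis by simp
qed

text \<open>Each use of the one-variable bound opens the next integral, whose range up to
  \<open>x i\<close> is enlarged to \<open>b i\<close>. In the final argument only variable 0 keeps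
  its own upper limit.\<close>

lemma abs_delta_partials_le_inner:
  assumes f: "f \<in> class_L T a b n" and "i + l = n" "x \<in> PiE {..<n} (partials_dom S i)"
  shows "ennreal \<bar>delta_partials S i f x\<bar>
    \<le> inner_nn_integral T a b l i (\<lambda>y. ennreal \<bar>mixed_deriv T a b n f y\<bar>) x"
  using assms(2-)
proof (induction l arbitrary: i x)
  case 0
  then show ?case by (simp add: mixed_deriv_def)
next
  case (Suc l)
  then have i: "i < n" by simp
  interpret I: ts_interval "T i" "a i" "b i" using i by (rule interval)
  have xi: "x i \<le> b i" using Suc.prems i by (auto simp: PiE_partials_dom_iff ts_box_def)
  let ?D = "\<lambda>t. ennreal \<bar>delta_partials S (Suc i) f (x(i := t))\<bar>"
  let ?N = "\<lambda>t. inner_nn_integral T a b l (Suc i) (\<lambda>y. ennreal \<bar>mixed_deriv T a b n f y\<bar>) (x(i := t))"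
  have le: "?D t \<le> ?N t" if "t \<in> J i" for t
  proof (rule Suc.IH)
    have "t \<in> ts_kappa (S i)" using I.Ico_subset_kappa that by (auto simp: ts_box_def)
    then show "x(i := t) \<in> PiE {..<n} (partials_dom S (Suc i))"
      using Suc.prems i by (intro in_partials_dom_upd)
  qed (use Suc.prems in simp)
  have "ennreal \<bar>delta_partials S i f x\<bar> \<le> (\<integral>\<^sup>+t\<in>T i \<inter> {a i..<x i}. ?D t \<partial>\<mu> i)"
    using f i Suc.prems(2) by (rule abs_delta_partials_le)
  also have "\<dots> \<le> (\<integral>\<^sup>+t\<in>J i. ?N t \<partial>\<mu> i)"
  proof (rule nn_integral_mono)
    show "?D t * indicator (T i \<inter> {a i..<x i}) t \<le> ?N t * indicator (J i) t" for t
      using le[of t] xi by (auto simp: indicator_def simp del: delta_partials.simps)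
  qed
  finally show ?case by simp
qed

lemma initial_box_in_dom:
  assumes "x \<in> Q n"
  shows "x \<in> PiE {..<n} (partials_dom S n)" "x \<in> PiE {..<n} S"
proof -
  have "x i \<in> ts_kappa (S i) \<and> x i \<in> S i" if "i < n" for i
    using assms that ts_interval.Ico_subset_kappa[OF interval[OF that]]
    by (force simp: initial_box_def ts_box_def)
  then show "x \<in> PiE {..<n} (partials_dom S n)" "x \<in> PiE {..<n} S"
    using assms by (auto simp: initial_box_def PiE_iff partials_dom_def)
qed

text \<open>Regularity of the mixed derivative is known only on the truncated factors. Flooring each
  coordinate gives a representative measurable on the whole product that is unchanged on the
  half-open box. For \<open>n = 0\<close> the class makes no rd-continuity statement, hence the
  condition \<open>1 \<le> n\<close>.\<close>

lemma measurable_abs_mixed_deriv: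
  assumes f: "f \<in> class_L T a b n" and n: "1 \<le> n"
  obtains w where "w \<in> borel_measurable product_borel" "\<And>y. (0::real) \<le> w y"
    "\<And>y. y \<in> Q n \<Longrightarrow> w y = \<bar>mixed_deriv T a b n f y\<bar>"
proof
  let ?K = "partials_dom S n"
  let ?p = "\<lambda>x i. if i < n then ts_floor (?K i) (x i) else undefined"
  let ?w = "\<lambda>y. \<bar>mixed_deriv T a b n f (?p y)\<bar>"
  have K: "closed (?K i) \<and> ?K i \<noteq> {} \<and> bdd_below (?K i)" if "i < n" for i
  proof -
    interpret I: ts_interval "T i" "a i" "b i" using that by (rule interval)
    have "?K i = ts_kappa (T i \<inter> {a i..b i})" using that by (simp add: partials_dom_def ts_box_def)
    then show ?thesis using I.closed_kappa I.a_in_kappa I.bdd_kappa by (simp add: ex_in_conv[symmetric]) blast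
  qed
  have "rd_continuous_prod ?K n (mixed_deriv T a b n f)"
    using f n by (auto simp: class_L_def mixed_deriv_def)
  from borel_measurable_rd_continuous_prod[OF K this]
  show "?w \<in> borel_measurable product_borel" by (intro borel_measurable_abs) auto
  show "?w y = \<bar>mixed_deriv T a b n f y\<bar>" if "y \<in> Q n" for y
  proof -
    have "y \<in> PiE {..<n} ?K" using initial_box_in_dom(1)[OF that] .
    then have "?p y = y"
      using K by (auto simp: fun_eq_iff PiE_iff extensional_def ts_floor_id)
    then show ?thesis by simp
  qed
qed simp

end

section \<open>The inequality\<close>

theorem theorem3p1:
  fixes n :: nat and T :: "nat \<Rightarrow> real set" and a b :: "nat \<Rightarrow> real"
    and R :: ereal and F :: "real ^ 'm \<Rightarrow> real"
    and f :: "'m \<Rightarrow> (nat \<Rightarrow> real) \<Rightarrow> real"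
  assumes "1 \<le> n"
    and "\<forall>j<n. time_scale (T j)"
    and "a \<in> PiE {..<n} T" and "b \<in> PiE {..<n} T" and "\<forall>j<n. a j < b j"
    and "0 < R"
    and "F \<in> class_H R"
    and "\<forall>i. \<forall>x\<in>PiE {..<n} (ts_box T a b). - R < ereal (f i x) \<and> ereal (f i x) < R"
    and "\<forall>i. ereal (delta_integral T a b n (\<lambda>x. \<bar>mixed_deriv T a b n (f i) x\<bar>)) < R"
    and "\<forall>i. f i \<in> class_L T a b n"
  shows "delta_integral T a b n
           (\<lambda>x. \<Sum>i\<in>UNIV. partial_deriv i F (\<chi> k. \<bar>f k x\<bar>) * \<bar>mixed_deriv T a b n (f i) x\<bar>)
         \<le> F (\<chi> i. delta_integral T a b n (\<lambda>x. \<bar>mixed_deriv T a b n (f i) x\<bar>))"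
proof -
  interpret ts_intervals n T a b
    by unfold_locales (use assms(2-5) in \<open>auto simp: PiE_iff\<close>)
  obtain m where n: "n = Suc m" using assms(1) by (cases n) auto
  have n0: "0 < n" using n by simp
  note R = assms(6) and F = assms(7) and L = assms(10)[rule_format]
  let ?\<Phi> = "\<lambda>i. mixed_deriv T a b n (f i)" and ?o = "\<lambda>_::nat. undefined :: real"
  have "\<exists>w. w \<in> borel_measurable product_borel \<and> (\<forall>y. (0::real) \<le> w y) \<and> (\<forall>y\<in>Q n. w y = \<bar>?\<Phi> i y\<bar>)" for i
    using measurable_abs_mixed_deriv[OF L assms(1)] by metis
  then obtain w where w: "\<And>i. w i \<in> borel_measurable product_borel" "\<And>i y. (0::real) \<le> w i y"
    and w_eq: "\<And>i y. y \<in> Q n \<Longrightarrow> w i y = \<bar>?\<Phi> i y\<bar>"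
    by metis
  have wn: "(\<lambda>y. ennreal (w i y)) \<in> borel_measurable product_borel" for i
    using w(1)[of i] by measurable
  have o: "?o \<in> Q 0" by (auto simp: initial_box_def extensional_def)
  define W where "W i l j = inner_nn_integral T a b l j (\<lambda>y. ennreal (w i y))" for i l j
  have W_abs: "inner_nn_integral T a b l j (\<lambda>y. ennreal \<bar>?\<Phi> i y\<bar>) x = W i l j x"
    if "x \<in> Q j" "j + l = n" for i l j x
    unfolding W_def using that w_eq by (intro inner_nn_integral_cong) auto
  have W_fin: "W i n 0 ?o < \<infinity>" for i
    using L[of i] W_abs[OF o, of n i] by (simp add: class_L_def delta_nn_integral_eq_inner)
  have total: "delta_integral T a b n (\<lambda>x. \<bar>?\<Phi> i x\<bar>) = enn2real (W i n 0 ?o)" for i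
  proof -
    have "delta_integral T a b n (\<lambda>x. \<bar>?\<Phi> i x\<bar>) = inner_integral T a b n 0 (w i) ?o"
      unfolding delta_integral_eq_inner using o w_eq by (intro inner_integral_cong) auto
    also have "\<dots> = enn2real (W i n 0 ?o)"
      using w o W_fin[of i] unfolding W_def
      by (intro inner_integral_eq_nn) (auto simp: initial_box_def)
    finally show ?thesis .
  qed
  define X where "X t = ?o(0 := t)" for t
  have X_Q: "X t \<in> Q 1" if "t \<in> J 0" for t
    using initial_box_upd[OF o n0 that] by (simp add: X_def)
  \<comment> \<open>\<open>\<phi> i t\<close> is the mass of
    \<open>\<bar>mixed_deriv T a b n (f i)\<bar>\<close> on the slice with first coordinate
    \<open>t\<close>. Its real version \<open>N i\<close> will be the density of \<open>H\<close>
    with respect to \<open>\<mu> 0\<close>.\<close>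
  define \<phi> where "\<phi> i = (\<lambda>t. W i m 1 (X t) * indicator (J 0) t)" for i
  have [measurable_cong]: "sets (\<mu> 0) = sets borel" by (rule sets_delta)
  have [measurable]: "J 0 \<in> sets borel" using n0 by (rule sets_J)
  have [measurable]: "(\<lambda>t. W i m 1 (X t)) \<in> borel_measurable (\<mu> 0)" for i
    unfolding W_def X_def using wn n o
    by (intro measurable_slice borel_measurable_inner_nn_integral) (auto simp: initial_box_def)
  have \<phi>_meas [measurable]: "\<phi> i \<in> borel_measurable (\<mu> 0)" for i unfolding \<phi>_def by measurable
  have \<phi>_int: "integral\<^sup>N (\<mu> 0) (\<phi> i) = W i n 0 ?o" for i
    by (simp add: \<phi>_def W_def X_def n)
  have \<phi>_fin: "integral\<^sup>N (\<mu> 0) (\<phi> i) < \<infinity>" for i using W_fin by (simp add: \<phi>_int)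
  define N where "N i t = enn2real (\<phi> i t)" for i t
  have N_int: "integrable (\<mu> 0) (N i)" for i
    unfolding N_def using \<phi>_fin by (intro integrable_enn2real) auto
  have N_total: "(\<integral>t. N i t \<partial>\<mu> 0) = delta_integral T a b n (\<lambda>x. \<bar>?\<Phi> i x\<bar>)" for i
    unfolding N_def total \<phi>_int[symmetric] using \<phi>_fin by (intro integrable_enn2real) auto
  have N0: "0 \<le> N i t" for i t by (simp add: N_def)
  have supp: "N i t = 0" if "t \<notin> {a 0..<b 0}" for i t using that by (auto simp: N_def \<phi>_def)
  have less: "ereal (\<integral>t. N i t \<partial>\<mu> 0) < R" for i using assms(9) by (simp add: N_total)
  define H where "H t = (\<chi> i. \<integral>s. indicator {..<t} s * N i s \<partial>\<mu> 0)" for t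
  note chain = R F sets_delta[of 0] N_int N0 supp less
  have H_cube: "H t \<in> nonneg_cube R" for t
    unfolding H_def by (rule class_H_chain_in_cube[OF chain])
  have f_le: "\<bar>f i x\<bar> \<le> H (x 0) $ i" if x: "x \<in> Q n" for i x
  proof -
    have xS: "x \<in> PiE {..<n} S" using initial_box_in_dom(2)[OF x] .
    then have xd: "x \<in> PiE {..<n} (partials_dom S 0)" by (simp add: partials_dom_def[abs_def])
    \<comment> \<open>Cut off at \<open>x 0\<close>, the slice mass integrates to
      \<open>H (x 0) $ i\<close>.\<close>
    define \<psi> where "\<psi> t = indicator {..<x 0} t * \<phi> i t" for t
    have [measurable]: "\<psi> \<in> borel_measurable (\<mu> 0)" unfolding \<psi>_def by measurable
    have "integral\<^sup>N (\<mu> 0) \<psi> \<le> integral\<^sup>N (\<mu> 0) (\<phi> i)"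
      by (intro nn_integral_mono) (auto simp: \<psi>_def indicator_def)
    with \<phi>_fin[of i] have \<psi>_fin: "integral\<^sup>N (\<mu> 0) \<psi> < \<infinity>" by simp
    have x0: "x 0 < b 0" using x n0 by (auto simp: initial_box_def)
    have "ennreal \<bar>f i x\<bar> \<le> (\<integral>\<^sup>+t\<in>T 0 \<inter> {a 0..<x 0}. ennreal \<bar>delta_partials S (Suc 0) (f i) (x(0 := t))\<bar> \<partial>\<mu> 0)"
      using abs_delta_partials_le[OF L n0 xd] by simp
    also have "\<dots> \<le> integral\<^sup>N (\<mu> 0) \<psi>"
    proof (rule nn_integral_mono)
      fix t
      show "ennreal \<bar>delta_partials S (Suc 0) (f i) (x(0 := t))\<bar> * indicator (T 0 \<inter> {a 0..<x 0}) t \<le> \<psi> t"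
      proof (cases "t \<in> T 0 \<inter> {a 0..<x 0}")
        case True
        then have t: "t \<in> J 0" using x0 by auto
        have "t \<in> ts_kappa (S 0)"
          using ts_interval.Ico_subset_kappa[OF interval[OF n0]] t by (auto simp: ts_box_def)
        then have "x(0 := t) \<in> PiE {..<n} (partials_dom S (Suc 0))"
          using xd n0 by (intro in_partials_dom_upd)
        then have "ennreal \<bar>delta_partials S (Suc 0) (f i) (x(0 := t))\<bar>
            \<le> inner_nn_integral T a b m (Suc 0) (\<lambda>y. ennreal \<bar>?\<Phi> i y\<bar>) (x(0 := t))"
          using n by (intro abs_delta_partials_le_inner[OF L]) simp_all
        also have "\<dots> = inner_nn_integral T a b m (Suc 0) (\<lambda>y. ennreal \<bar>?\<Phi> i y\<bar>) (X t)"
          using x n by (intro inner_nn_integral_depends) (auto simp: X_def initial_box_def extensional_def)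
        also have "\<dots> = W i m 1 (X t)" using W_abs[OF X_Q[OF t]] n by simp
        also have "\<dots> = \<psi> t" using True t by (simp add: \<psi>_def \<phi>_def)
        finally show ?thesis using True by (simp del: delta_partials.simps)
      qed simp
    qed
    finally have "enn2real (ennreal \<bar>f i x\<bar>) \<le> enn2real (integral\<^sup>N (\<mu> 0) \<psi>)"
      using \<psi>_fin by (intro enn2real_mono) auto
    also have "\<dots> = (\<integral>t. enn2real (\<psi> t) \<partial>\<mu> 0)"
      using \<psi>_fin by (intro integrable_enn2real(2)[symmetric]) auto
    also have "\<dots> = H (x 0) $ i"
      unfolding H_def vec_lambda_beta
      by (intro Bochner_Integration.integral_cong) (auto simp: \<psi>_def N_def indicator_def)
    finally show ?thesis by simp
  qed
  let ?h = "\<lambda>x. \<Sum>i\<in>UNIV. partial_deriv i F (\<chi> k. \<bar>f k x\<bar>) * \<bar>?\<Phi> i x\<bar>"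
  define c where "c t i = partial_deriv i F (H t)" for t i
  have c0: "0 \<le> c t i" for t i
    unfolding c_def by (rule partial_deriv_nonneg[OF R F H_cube])
  have h_le: "?h x \<le> (\<Sum>i\<in>UNIV. c (x 0) i * w i x)" if x: "x \<in> Q n" for x
  proof (rule sum_mono)
    fix i
    have "ereal \<bar>f k x\<bar> < R" for k
    proof -
      have "ereal \<bar>f k x\<bar> \<le> ereal (H (x 0) $ k)" using f_le[OF x] by simp
      also have "\<dots> < R" using H_cube by (auto simp: nonneg_cube_def)
      finally show ?thesis .
    qed
    then have "(\<chi> k. \<bar>f k x\<bar>) \<in> nonneg_cube R" by (simp add: nonneg_cube_def)
    then have "partial_deriv i F (\<chi> k. \<bar>f k x\<bar>) \<le> c (x 0) i"
      unfolding c_def using f_le[OF x] by (intro partial_deriv_mono[OF R F] H_cube) auto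
    then show "partial_deriv i F (\<chi> k. \<bar>f k x\<bar>) * \<bar>?\<Phi> i x\<bar> \<le> c (x 0) i * w i x"
      using w_eq[OF x] by (simp add: mult_right_mono)
  qed
  \<comment> \<open>Where a slice mass is infinite, \<open>N\<close> has the default value 0 and is
    no longer a bound; these \<open>t\<close> form a null set.\<close>
  have "AE t in \<mu> 0. \<phi> i t \<noteq> \<infinity>" for i
    using \<phi>_fin[of i] by (intro nn_integral_noteq_infinite) auto
  then have "AE t in \<mu> 0. \<forall>i\<in>UNIV. \<phi> i t \<noteq> \<infinity>" by (subst AE_finite_all) auto
  then have ae: "AE t in \<mu> 0. indicator (J 0) t *\<^sub>R inner_integral T a b m 1 ?h (X t)
      \<le> (\<Sum>i\<in>UNIV. partial_deriv i F (H t) * N i t)"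
  proof eventually_elim
    case (elim t)
    show ?case
    proof (cases "t \<in> J 0")
      case True
      have "inner_integral T a b m 1 ?h (X t)
          \<le> (\<Sum>i\<in>UNIV. c t i * enn2real (inner_nn_integral T a b m 1 (\<lambda>y. ennreal (w i y)) (X t)))"
      \<comment> \<open>The majorant is required only at points \<open>y\<close> with
        \<open>y 0 = t\<close>, which is why the coefficients may depend on \<open>t\<close> and
        still act as constants for the inner integrals.\<close>
      proof (rule inner_integral_le[OF w c0 _ X_Q[OF True]])
        show "?h y \<le> (\<Sum>i\<in>UNIV. c t i * w i y)" if "y \<in> Q n" "\<And>k. k < 1 \<Longrightarrow> y k = X t k" for y
          using h_le[OF that(1)] that(2)[of 0] by (simp add: X_def)
        show "inner_nn_integral T a b m 1 (\<lambda>y. ennreal (w i y)) (X t) < \<infinity>" for i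
          using elim True by (simp add: \<phi>_def W_def less_top)
      qed (use n in auto)
      then show ?thesis using True by (simp add: c_def N_def \<phi>_def W_def)
    qed (simp add: N_def \<phi>_def)
  qed
  have "delta_integral T a b n ?h
      = (\<integral>t. indicator (J 0) t *\<^sub>R inner_integral T a b m 1 ?h (X t) \<partial>\<mu> 0)"
    unfolding delta_integral_eq_inner by (simp add: n set_lebesgue_integral_def X_def)
  also have "\<dots> \<le> (\<integral>t. (\<Sum>i\<in>UNIV. partial_deriv i F (H t) * N i t) \<partial>\<mu> 0)"
  \<comment> \<open>The non-negativity goal covers a left-hand integral that does not exist and
    hence equals 0.\<close>
  proof (rule integral_mono_AE'[OF _ ae])
    show "integrable (\<mu> 0) (\<lambda>t. \<Sum>i\<in>UNIV. partial_deriv i F (H t) * N i t)"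
      unfolding H_def by (rule integrable_class_H_chain[OF chain])
    show "AE t in \<mu> 0. 0 \<le> (\<Sum>i\<in>UNIV. partial_deriv i F (H t) * N i t)"
      using c0 N0 by (auto intro!: AE_I2 sum_nonneg simp: c_def)
  qed
  also have "\<dots> \<le> F (\<chi> i. \<integral>t. N i t \<partial>\<mu> 0)"
    unfolding H_def by (rule integral_class_H_chain_le[OF chain])
  finally show ?thesis by (simp add: N_total)
qed

end
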